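(* Let $0<q<1$, $\sigma>0$, $0\le\gamma<2$, and assume that either $\gamma\in\{0,1\}$, or $\gamma\in(0,2)\setminus\{1\}$ and $q^{-1}(1-q)(1-q^{\gamma+1})(1-q^{\gamma+2})>1$. Then: (a) The radius of convexity $r^{c}(g_{\gamma,\sigma}(z;q))$ satisfies $$\frac{\Gamma_{q}(\gamma+3)}{9\sigma^2\Gamma_{q}(\gamma+1)}<\left(r^{c}(g_{\gamma,\sigma}(z;q))\right)^2<\frac{9\Gamma_{q}(\gamma+3)\Gamma_{q}(\gamma+5)}{\sigma^2\left(81\Gamma_{q}(\gamma+1)\Gamma_{q}(\gamma+5)-50q^2\Gamma_{q}^2(\gamma+3)\right)}.$$ (b) The radius of convexity $r^{c}(h_{\gamma,\sigma}(z;q))$ satisfies $$\frac{\Gamma_{q}(\gamma+3)}{4\sigma^2\Gamma_{q}(\gamma+1)}<r^{c}(h_{\gamma,\sigma}(z;q))<\frac{2\Gamma_{q}(\gamma+3)\Gamma_{q}(\gamma+5)}{\sigma^2\left(8\Gamma_{q}(\gamma+1)\Gamma_{q}(\gamma+5)-9q^2\Gamma_{q}^2(\gamma+3)\right)}.$$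
   Context: For $0<q<1$, $(a;q)_\infty=\prod_{k\ge1}(1-aq^{k-1})$ and the $q$-gamma function is $\Gamma_q(z)=\frac{(q;q)_\infty}{(q^z;q)_\infty}(1-q)^{1-z}$; $\Gamma_q^2(x)$ means $(\Gamma_q(x))^2$. For $\sigma>0$ and $0\le\gamma<2$ define the entire function $$\mathscr{E}_{\gamma,\sigma}(z;q)=\sum_{n\ge0}\frac{(-1)^n\sigma^{2n}q^{n(n-1)}}{\Gamma_q(2n+\gamma+1)}z^n ,$$ and the entire functions $g_{\gamma,\sigma}(z;q)=z\Gamma_q(\gamma+1)\mathscr{E}_{\gamma,\sigma}(z^2;q)$ and $h_{\gamma,\sigma}(z;q)=z\Gamma_q(\gamma+1)\mathscr{E}_{\gamma,\sigma}(z;q)$. Write $\mathbb{D}_r=\{z\in\mathbb{C}:|z|<r\}$. For an entire function $f$ with $f(0)=0$, $f'(0)=1$, the radius of convexity (of order $0$) is $$r^c(f)=\sup\left\{r>0:\ \operatorname{Re}\left(1+\frac{zf''(z)}{f'(z)}\right)>0\ \text{for all } z\in\mathbb{D}_r\right\}$$ (the condition includes that $f'$ has no zeros in $\mathbb{D}_r$). *)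

theory Defs
  imports "HOL-Complex_Analysis.Complex_Analysis"
begin

definition qpochhammer_inf :: "'a \<Rightarrow> 'a \<Rightarrow> 'a::{real_normed_field,banach}" where
  "qpochhammer_inf a q = (\<Prod>k. 1 - a * q ^ k)"

text \<open>
  Stated generically so that the argument \<open>z\<close> may be real or complex; for \<open>0 < q < 1\<close> the
  powers \<open>q powr z\<close> and \<open>(1 - q) powr (1 - z)\<close> have positive real base, hence no branch choice
  is involved. At the poles the value is \<open>0\<close>, since division by zero is zero.
\<close>
definition qGamma :: "real \<Rightarrow> 'a \<Rightarrow> 'a::{real_normed_field,banach,ln}" where
  "qGamma q z = qpochhammer_inf (of_real q) (of_real q)
                / qpochhammer_inf (of_real q powr z) (of_real q) * of_real (1 - q) powr (1 - z)"

definition qE :: "real \<Rightarrow> real \<Rightarrow> complex \<Rightarrow> real \<Rightarrow> complex" where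
  "qE \<gamma> \<sigma> z q =
     (\<Sum>n. of_real ((-1) ^ n * \<sigma> ^ (2 * n) * q ^ (n * (n - 1)) / qGamma q (2 * real n + \<gamma> + 1)) * z ^ n)"

definition g_fun :: "real \<Rightarrow> real \<Rightarrow> real \<Rightarrow> complex \<Rightarrow> complex" where
  "g_fun \<gamma> \<sigma> q z = z * of_real (qGamma q (\<gamma> + 1)) * qE \<gamma> \<sigma> (z ^ 2) q"

definition h_fun :: "real \<Rightarrow> real \<Rightarrow> real \<Rightarrow> complex \<Rightarrow> complex" where
  "h_fun \<gamma> \<sigma> q z = z * of_real (qGamma q (\<gamma> + 1)) * qE \<gamma> \<sigma> z q"

text \<open>
  Extended-real valued, because the supremum is infinite for e.g. the identity function. The
  condition on the derivative is explicit because division by zero is zero, so that the real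
  part below would be \<open>1\<close> at a zero of the derivative.
\<close>
definition radius_of_convexity :: "(complex \<Rightarrow> complex) \<Rightarrow> ereal" where
  "radius_of_convexity f = Sup {ereal r | r. r > 0 \<and>
     (\<forall>z\<in>ball 0 r. deriv f z \<noteq> 0 \<and> Re (1 + z * deriv (deriv f) z / deriv f z) > 0)}"

end

theory Submission
  imports Defs
begin

text \<open>
  Put \<open>P(w) = \<Sum>\<^sub>k (-1)\<^sup>k c\<^sub>k w\<^sup>k\<close>, so that \<open>g(z) = z P(z\<^sup>2)\<close> and \<open>h(z) = z P(z)\<close> are instances of
  \<open>f(z) = z P(z\<^sup>m)\<close>. With \<open>\<theta> F = F + m w F'\<close>, \<open>A = \<theta> P\<close>, \<open>B = \<theta> A\<close> and \<open>w = z\<^sup>m\<close> one has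
  \<open>1 + z f''/f' = B(w)/A(w)\<close>. If all roots of \<open>P\<close> are positive, the same holds for \<open>A\<close> and \<open>B\<close>
  by Rolle's theorem, and the \<open>m\<close>-th power of the radius of convexity is the least root of \<open>B\<close>. The
  power sums \<open>s\<^sub>j\<close> of the reciprocal roots of \<open>B\<close> confine that root between \<open>1/\<surd>s\<^sub>2 > 1/s\<^sub>1\<close> and
  \<open>s\<^sub>2/s\<^sub>3 < s\<^sub>1/s\<^sub>2\<close>. These estimates are made for polynomials approximating \<open>P\<close> and survive the
  limit; the two strict inequalities between the limiting power sums follow from \<open>4 e\<^sub>2 \<le> e\<^sub>1\<^sup>2\<close> for
  the coefficients \<open>e\<^sub>k = (1 + mk)\<^sup>2 c\<^sub>k\<close> of \<open>B\<close>.

  For \<open>\<gamma> \<in> {0, 1}\<close> the approximants are Wall polynomials of base \<open>p = q\<^sup>2\<close>. They arise from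
  \<open>\<Prod>\<^sub>k (1 - s p\<^sup>k w)\<close> by the operators \<open>f(w) \<mapsto> f(w) - a p\<^sup>j f(pw)\<close>, which preserve the property
  that the roots are positive with consecutive ratios at least \<open>1/p\<close>. For other \<open>\<gamma>\<close> the hypothesis
  forces \<open>q < 1/2\<close>, hence \<open>c\<^sub>k\<^sup>2 > 4 c\<^sub>k\<^sub>-\<^sub>1 c\<^sub>k\<^sub>+\<^sub>1\<close>, and Hutchinson's criterion applies to the
  truncations of \<open>P\<close>.
\<close>

subsection \<open>Polynomials with positive roots\<close>

text \<open>Normalised by the constant term \<open>1\<close> rather than by the leading coefficient,
  so that coefficientwise limits make sense while the degree grows. The coefficients are then, up to
  sign, the elementary symmetric functions of the \<open>1 / x i\<close>.\<close>

definition root_prod :: "(nat \<Rightarrow> real) \<Rightarrow> nat \<Rightarrow> real poly" where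
  "root_prod x n = (\<Prod>i<n. [:1, - (1 / x i):])"

lemma poly_root_prod: "poly (root_prod x n) w = (\<Prod>i<n. 1 - w / x i)"
  by (simp add: root_prod_def poly_prod)

lemma root_prod_0 [simp]: "root_prod x 0 = 1"
  by (simp add: root_prod_def)

lemma root_prod_Suc: "root_prod x (Suc n) = root_prod x n * [:1, - (1 / x n):]"
  by (simp add: root_prod_def)

lemma coeff_root_prod_0 [simp]: "coeff (root_prod x n) 0 = 1"
  by (induction n) (simp_all add: root_prod_Suc coeff_mult)

lemma degree_root_prod_le: "degree (root_prod x n) \<le> n"
proof (induction n)
  case (Suc n)
  show ?case unfolding root_prod_Suc
    by (rule order.trans[OF degree_mult_le]) (use Suc in simp)
qed simp

text \<open>Two polynomials of degree at most \<open>n\<close> that agree at the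
  \<open>n + 1\<close> points \<open>0\<close> and \<open>y i\<close> are equal.\<close>

lemma eq_root_prod:
  assumes "degree p \<le> n" and "poly p 0 = 1" and "inj_on y {..<n}"
    and "\<And>i. i < n \<Longrightarrow> y i \<noteq> 0 \<and> poly p (y i) = 0"
  shows "p = root_prod y n"
proof (rule poly_eqI_degree[where A = "insert 0 (y ` {..<n})"])
  fix x assume "x \<in> insert 0 (y ` {..<n})"
  thus "poly p x = poly (root_prod y n) x"
    using assms(2,4) by (auto simp: poly_root_prod)
next
  have "card (insert 0 (y ` {..<n})) = Suc n"
    using assms(3,4) by (subst card_insert_disjoint) (auto simp: card_image)
  thus "degree p < card (insert 0 (y ` {..<n}))"
    and "degree (root_prod y n) < card (insert 0 (y ` {..<n}))"
    using assms(1) degree_root_prod_le[of y n] by simp_all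
qed

lemma strict_mono_on_lessThanI:
  fixes f :: "nat \<Rightarrow> 'a::order"
  assumes "\<And>i. Suc i < n \<Longrightarrow> f i < f (Suc i)"
  shows "strict_mono_on {..<n} f"
proof (rule strict_mono_onI)
  fix r s :: nat assume "r \<in> {..<n}" "s \<in> {..<n}" and "r < s"
  hence "s < n" by simp
  with \<open>r < s\<close> show "f r < f s"
  proof (induction s)
    case (Suc s)
    show ?case
    proof (cases "r = s")
      case True
      thus ?thesis using assms Suc.prems by simp
    next
      case False
      hence "f r < f s" using Suc by simp
      also have "f s < f (Suc s)" using assms Suc.prems by simp
      finally show ?thesis .
    qed
  qed simp
qed

text \<open>In terms of \<open>w = z ^ m\<close>, this is the passage from
  \<open>z * p(z ^ m)\<close> to its derivative. The Rolle points already number \<open>n\<close>,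
  hence exhaust the degree. The comparison \<open>y i < x i\<close> is what later confines the roots
  of the numerator and the denominator of the quotient at once.\<close>

lemma euler_operator_root_prod:
  fixes x :: "nat \<Rightarrow> real" and m n :: nat
  assumes x: "strict_mono_on {..<n} x" and pos: "\<And>i. i < n \<Longrightarrow> 0 < x i" and "m > 0"
  defines "p \<equiv> root_prod x n"
  obtains y where "strict_mono_on {..<n} y" and "\<And>i. i < n \<Longrightarrow> 0 < y i \<and> y i < x i"
    and "p + smult (of_nat m) (pCons 0 (pderiv p)) = root_prod y n"
proof -
  define r where "r = p + smult (of_nat m) (pCons 0 (pderiv p))"
  \<comment> \<open>The first interval starts at \<open>0\<close>, because the factor
    \<open>w\<close> makes \<open>w * p(w) ^ m\<close> vanish there too.\<close>
  define lo where "lo k = (if k = 0 then 0 else x (k - 1))" for k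
  have step: "x i < x (Suc i)" if "Suc i < n" for i
    using strict_mono_onD[OF x, of i "Suc i"] that by simp
  have lo_less: "lo k < x k" if "k < n" for k
    using that pos step[of "k - 1"] by (auto simp: lo_def)
  have root: "\<exists>y. lo k < y \<and> y < x k \<and> poly r y = 0" if k: "k < n" for k
  proof -
    \<comment> \<open>Rolle's theorem for \<open>w p(w)\<^sup>m\<close>, whose derivative is \<open>p(w)\<^sup>m\<^sup>-\<^sup>1 (p(w) + m w p'(w))\<close>\<close>
    define F where "F w = w * poly p w ^ m" for w
    have F': "(F has_real_derivative poly p w ^ (m - 1) * poly r w) (at w)" for w
    proof -
      have pw: "poly p w ^ m = poly p w ^ (m - 1) * poly p w"
        using \<open>m > 0\<close> by (metis power_minus_mult)
      show ?thesis unfolding F_def r_def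
        by (rule derivative_eq_intros refl)+ (simp add: pw algebra_simps)
    qed
    have "poly p (x k) = 0"
      unfolding p_def poly_root_prod using k pos[OF k] by (intro prod_zero) (auto intro!: bexI[of _ k])
    moreover have "F (lo k) = 0"
    proof (cases "k = 0")
      case False
      hence "poly p (lo k) = 0"
        unfolding p_def poly_root_prod using k pos[of "k - 1"]
        by (intro prod_zero) (auto simp: lo_def less_imp_diff_less intro!: bexI[of _ "k - 1"])
      thus ?thesis using \<open>m > 0\<close> by (simp add: F_def)
    qed (simp add: F_def lo_def)
    ultimately have "F (lo k) = F (x k)" using \<open>m > 0\<close> by (auto simp: F_def)
    then obtain y where y: "lo k < y" "y < x k" and "poly p y ^ (m - 1) * poly r y = 0"
      using Rolle_deriv[OF lo_less[OF k], of F "\<lambda>w. (*) (poly p w ^ (m - 1) * poly r w)"] F'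
      by (auto simp: has_field_derivative_def fun_eq_iff
          intro!: continuous_at_imp_continuous_on DERIV_isCont[OF F'] dest: spec[of _ 1])
    \<comment> \<open>The open interval between \<open>lo k\<close> and \<open>x k\<close> contains
      no root of \<open>p\<close>, so the factor \<open>poly p y ^ (m - 1)\<close> can be
      cancelled.\<close>
    moreover have "poly p y \<noteq> 0"
    proof -
      have "y \<noteq> x i" if "i < n" for i
      proof (cases "i < k")
        case True
        hence "x i \<le> lo k"
          using strict_mono_on_leD[OF x, of i "k - 1"] k True by (simp add: lo_def less_imp_diff_less)
        thus ?thesis using y by simp
      next
        case False
        hence "x k \<le> x i"
          using strict_mono_onD[OF x, of k i] k that by (cases "i = k") auto
        thus ?thesis using y by simp
      qed
      thus ?thesis using pos unfolding p_def poly_root_prod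
        by (force simp: prod_zero_iff field_simps)
    qed
    ultimately show ?thesis by auto
  qed
  then obtain y where y: "lo k < y k" "y k < x k" "poly r (y k) = 0" if "k < n" for k
    by metis
  have ypos: "0 < y k" if "k < n" for k
    using y(1)[OF that] that pos[of "k - 1"] by (cases "k = 0") (force simp: lo_def less_imp_diff_less)+
  have mono: "strict_mono_on {..<n} y"
  proof (rule strict_mono_on_lessThanI)
    fix i assume "Suc i < n"
    thus "y i < y (Suc i)" using y(2)[of i] y(1)[of "Suc i"] by (simp add: lo_def)
  qed
  have "r = root_prod y n"
  proof (rule eq_root_prod)
    have dp: "degree p \<le> n" by (simp add: p_def degree_root_prod_le)
    moreover have "degree (pCons 0 (pderiv p)) \<le> n"
      using dp by (cases "degree p = 0") (auto simp: degree_pderiv pderiv_eq_0_iff)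
    ultimately show "degree r \<le> n" unfolding r_def
      by (intro degree_add_le) (auto intro: order.trans[OF degree_smult_le])
    show "poly r 0 = 1" by (simp add: r_def p_def poly_root_prod)
    show "inj_on y {..<n}" using mono by (rule strict_mono_on_imp_inj_on)
  qed (use y ypos in fastforce)
  thus thesis using that mono y(2) ypos unfolding r_def by blast
qed

text \<open>Exactly the first \<open>k\<close> factors are nonpositive. The inequalities are weak so
  that \<open>w\<close> may itself be a root, which happens at interval ends when the root
  separation is tight.\<close>

lemma root_prod_sign:
  assumes "k \<le> n" and "\<And>i. i < n \<Longrightarrow> 0 < x i"
    and "\<And>i. i < k \<Longrightarrow> x i \<le> w" and "\<And>i. k \<le> i \<Longrightarrow> i < n \<Longrightarrow> w \<le> x i"
  shows "0 \<le> (- 1) ^ k * poly (root_prod x n) w"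
proof -
  have "(\<Prod>i<n. 1 - w / x i) = (\<Prod>i<k. 1 - w / x i) * (\<Prod>i\<in>{k..<n}. 1 - w / x i)"
    using assms(1) by (metis atLeast0LessThan le0 prod.atLeastLessThan_concat)
  moreover have "(\<Prod>i<k. 1 - w / x i) = (- 1) ^ k * (\<Prod>i<k. w / x i - 1)"
    using prod.distrib[of "\<lambda>_. - 1 :: real" "\<lambda>i. w / x i - 1" "{..<k}"] by simp
  moreover have "0 \<le> (\<Prod>i<k. w / x i - 1)"
    using assms by (intro prod_nonneg) (auto simp: field_simps)
  moreover have "0 \<le> (\<Prod>i\<in>{k..<n}. 1 - w / x i)"
    using assms by (intro prod_nonneg) (auto simp: field_simps)
  ultimately show ?thesis unfolding poly_root_prod by (cases "even k") simp_all
qed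

text \<open>
  The roots of \<open>f(w)\<close> and \<open>f(pw)\<close> interlace when consecutive roots of \<open>f\<close> have ratio at least
  \<open>1/p\<close>; the roots of \<open>f(w) - b f(pw)\<close> then lie in the intervals \<open>[x\<^sub>k\<^sub>-\<^sub>1/p, x\<^sub>k]\<close>.
\<close>
lemma q_shift_root_prod:
  fixes x :: "nat \<Rightarrow> real"
  assumes p: "0 < p" "p < 1" and b: "0 < b" "b < 1"
    and pos: "\<And>i. i < n \<Longrightarrow> 0 < x i" and sep: "\<And>i. Suc i < n \<Longrightarrow> x i \<le> p * x (Suc i)"
  defines "f \<equiv> root_prod x n"
  obtains y where "\<And>i. i < n \<Longrightarrow> 0 < y i" and "\<And>i. Suc i < n \<Longrightarrow> y i \<le> p * y (Suc i)"
    and "smult (1 / (1 - b)) (f - smult b (pcompose f [:0, p:])) = root_prod y n"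
proof -
  define g where "g = f - smult b (pcompose f [:0, p:])"
  define lo where "lo k = (if k = 0 then 0 else x (k - 1) / p)" for k
  have gw: "poly g w = poly f w - b * poly f (p * w)" for w
    by (simp add: g_def poly_pcompose mult.commute)
  have step: "x i < x (Suc i)" if "Suc i < n" for i
  proof -
    have "p * x (Suc i) < x (Suc i)" using pos[OF that] p by simp
    thus ?thesis using sep[OF that] by linarith
  qed
  have mono: "strict_mono_on {..<n} x"
    by (rule strict_mono_on_lessThanI) (rule step)
  have le: "x i \<le> x j" if "i \<le> j" "j < n" for i j
    using strict_mono_onD[OF mono, of i j] that by (cases "i = j") auto
  have lo_le: "lo k \<le> x k" if "k < n" for k
    using that pos[OF that] sep[of "k - 1"] p by (auto simp: lo_def field_simps)
  have f0: "poly f (x k) = 0" if "k < n" for k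
    unfolding f_def poly_root_prod using that pos[OF that]
    by (intro prod_zero) (auto intro!: bexI[of _ k])
  have sgn_f: "0 \<le> (- 1) ^ k * poly f w"
    if "k < n" "w \<le> x k" "k > 0 \<Longrightarrow> x (k - 1) \<le> w" for k w
    unfolding f_def
  proof (rule root_prod_sign)
    show "x i \<le> w" if "i < k" for i
    proof -
      have "x i \<le> x (k - 1)" using that \<open>k < n\<close> by (intro le) auto
      also have "\<dots> \<le> w" using that by (intro \<open>k > 0 \<Longrightarrow> x (k - 1) \<le> w\<close>) simp
      finally show ?thesis .
    qed
    show "w \<le> x i" if "k \<le> i" "i < n" for i
      using le[of k i] that \<open>w \<le> x k\<close> by simp
  qed (use that pos in auto)
  have root: "\<exists>y. lo k \<le> y \<and> y \<le> x k \<and> poly g y = 0" if k: "k < n" for k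
  proof -
    \<comment> \<open>For \<open>k > 0\<close>, the point \<open>p * lo k = x (k - 1)\<close> is a
      root of \<open>f\<close>, so \<open>g\<close> agrees with \<open>f\<close> at
      \<open>lo k\<close>; for \<open>k = 0\<close> the value is \<open>1 - b > 0\<close>.\<close>
    have "0 \<le> (- 1) ^ k * poly g (lo k)"
    proof (cases "k = 0")
      case False
      hence "x (k - 1) \<le> lo k" using p pos[of "k - 1"] k by (simp add: lo_def field_simps)
      moreover have "poly g (lo k) = poly f (lo k)"
        using False f0[of "k - 1"] k p by (simp add: gw lo_def)
      ultimately show ?thesis using sgn_f[OF k lo_le[OF k]] by simp
    qed (use b in \<open>simp add: gw lo_def f_def poly_root_prod\<close>)
    \<comment> \<open>At \<open>x k\<close> only the term \<open>- b * f(p * x k)\<close> is left,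
      and the separation places \<open>p * x k\<close> between \<open>x (k - 1)\<close> and
      \<open>x k\<close>.\<close>
    moreover have "0 \<le> (- 1) ^ k * - poly g (x k)"
    proof -
      have "0 \<le> (- 1) ^ k * poly f (p * x k)"
        using k p pos[OF k] sep[of "k - 1"] by (intro sgn_f) (auto simp: field_simps)
      hence "0 \<le> b * ((- 1) ^ k * poly f (p * x k))" using b by simp
      thus ?thesis using f0[OF k] by (simp add: gw algebra_simps)
    qed
    ultimately have "(0 \<le> poly g (lo k) \<and> poly g (x k) \<le> 0) \<or> (poly g (lo k) \<le> 0 \<and> 0 \<le> poly g (x k))"
      by (cases "even k") auto
    moreover have "continuous_on {lo k..x k} (poly g)"
      by (simp add: continuous_at_imp_continuous_on)
    ultimately show ?thesis
      using IVT2'[of "poly g" "x k" 0 "lo k"] IVT'[of "poly g" "lo k" 0 "x k"] lo_le[OF k]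
      by auto
  qed
  then obtain y where y: "lo k \<le> y k" "y k \<le> x k" "poly g (y k) = 0" if "k < n" for k
    by metis
  have ypos: "0 < y k" if "k < n" for k
  proof (cases "k = 0")
    case True
    \<comment> \<open>The closed first interval contains \<open>0\<close>, which is excluded because
      \<open>g(0) = 1 - b\<close>.\<close>
    have "y 0 \<noteq> 0" using y(3)[of 0] that True b by (auto simp: gw f_def poly_root_prod)
    thus ?thesis using y(1)[of 0] that True by (simp add: lo_def)
  next
    case False
    hence "0 < lo k" using pos[of "k - 1"] that p by (simp add: lo_def)
    thus ?thesis using y(1)[OF that] by simp
  qed
  have ysep: "y i \<le> p * y (Suc i)" if "Suc i < n" for i
  proof -
    have "y i \<le> x i" using y(2) that by simp
    also have "x i = p * lo (Suc i)" using p by (simp add: lo_def)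
    also have "\<dots> \<le> p * y (Suc i)" using y(1)[OF that] p by simp
    finally show ?thesis .
  qed
  have "strict_mono_on {..<n} y"
  proof (rule strict_mono_on_lessThanI)
    fix i assume i: "Suc i < n"
    have "p * y (Suc i) < y (Suc i)" using ypos[OF i] p by simp
    thus "y i < y (Suc i)" using ysep[OF i] by linarith
  qed
  hence "smult (1 / (1 - b)) g = root_prod y n"
  proof (intro eq_root_prod strict_mono_on_imp_inj_on)
    have "degree f \<le> n" by (simp add: f_def degree_root_prod_le)
    moreover have "degree (pcompose f [:0, p:]) \<le> n"
      using order.trans[OF degree_pcompose_le[of f "[:0, p:]"]] \<open>degree f \<le> n\<close> p by simp
    ultimately have "degree g \<le> n" unfolding g_def
      by (intro degree_diff_le) (auto intro: order.trans[OF degree_smult_le])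
    thus "degree (smult (1 / (1 - b)) g) \<le> n"
      by (rule order.trans[OF degree_smult_le])
    show "poly (smult (1 / (1 - b)) g) 0 = 1"
      using b by (simp add: gw f_def poly_root_prod)
  qed (use y ypos in fastforce)+
  thus thesis using that ypos ysep unfolding g_def by blast
qed

section \<open>Power sums and logarithmic derivatives of root products\<close>

text \<open>Newton's identities up to order three. Appending the reciprocal root \<open>u\<close>
  changes the coefficient of index \<open>k + 1\<close> by \<open>- u\<close> times the coefficient
  of index \<open>k\<close>, which makes the induction step pure algebra.\<close>

lemma newton_sums_root_prod:
  defines "s \<equiv> \<lambda>x n j. \<Sum>i<n. (1 / x i :: real) ^ j"
  shows "coeff (root_prod x n) 1 = - s x n 1"
    and "2 * coeff (root_prod x n) 2 = s x n 1 ^ 2 - s x n 2"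
    and "6 * coeff (root_prod x n) 3 = - (s x n 1 ^ 3 - 3 * s x n 1 * s x n 2 + 2 * s x n 3)"
proof -
  have step: "coeff (root_prod x (Suc n)) (Suc k) =
      coeff (root_prod x n) (Suc k) - 1 / x n * coeff (root_prod x n) k" for n k
    by (simp add: root_prod_Suc mult.commute[of "root_prod x n"])
  have "coeff (root_prod x n) 1 = - s x n 1 \<and>
        2 * coeff (root_prod x n) 2 = s x n 1 ^ 2 - s x n 2 \<and>
        6 * coeff (root_prod x n) 3 = - (s x n 1 ^ 3 - 3 * s x n 1 * s x n 2 + 2 * s x n 3)"
  proof (induction n)
    case (Suc n)
    have s: "s x (Suc n) j = s x n j + (1 / x n) ^ j" for j
      by (simp add: s_def)
    have c: "coeff (root_prod x (Suc n)) 1 = coeff (root_prod x n) 1 - 1 / x n"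
      "coeff (root_prod x (Suc n)) 2 = coeff (root_prod x n) 2 - 1 / x n * coeff (root_prod x n) 1"
      "coeff (root_prod x (Suc n)) 3 = coeff (root_prod x n) 3 - 1 / x n * coeff (root_prod x n) 2"
      using step[of n 0] step[of n 1] step[of n 2] by (simp_all add: numeral_eq_Suc)
    define u where "u = 1 / x n"
    show ?case using Suc unfolding c s u_def[symmetric] by algebra
  qed (simp add: s_def)
  thus "coeff (root_prod x n) 1 = - s x n 1"
    and "2 * coeff (root_prod x n) 2 = s x n 1 ^ 2 - s x n 2"
    and "6 * coeff (root_prod x n) 3 = - (s x n 1 ^ 3 - 3 * s x n 1 * s x n 2 + 2 * s x n 3)"
    by blast+
qed

lemma sums_mult_linear_factor:
  fixes w :: "'a::real_normed_field"
  assumes "(\<lambda>k. of_real (c k) * w ^ k) sums S"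
  shows "(\<lambda>k. of_real (case k of 0 \<Rightarrow> 0 | Suc j \<Rightarrow> a * c j) * w ^ k) sums (of_real a * w * S)"
proof -
  have "(\<lambda>k. of_real a * w * (of_real (c k) * w ^ k)) sums (of_real a * w * S)"
    by (rule sums_mult) fact
  thus ?thesis
    using sums_Suc[of "\<lambda>k. of_real (case k of 0 \<Rightarrow> 0 | Suc j \<Rightarrow> a * c j) * w ^ k" "of_real a * w * S"]
    by (simp add: mult_ac)
qed

text \<open>The finite product is written as an infinite series so that approximants and their
  entire limit can be compared termwise.\<close>

lemma root_prod_sums:
  fixes w :: "'a::real_normed_field"
  shows "(\<lambda>k. of_real (coeff (root_prod x n) k) * w ^ k) sums (\<Prod>i<n. 1 - w / of_real (x i))"
proof (induction n)
  case 0
  show ?case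
    using sums_finite[of "{0}" "\<lambda>k. of_real (coeff (root_prod x 0) k) * w ^ k"] by simp
next
  case (Suc n)
  have "coeff (root_prod x (Suc n)) k =
      coeff (root_prod x n) k - (case k of 0 \<Rightarrow> 0 | Suc j \<Rightarrow> 1 / x n * coeff (root_prod x n) j)" for k
    by (simp add: root_prod_Suc mult.commute[of "root_prod x n"] coeff_pCons split: nat.split)
  thus ?case
    using sums_diff[OF Suc sums_mult_linear_factor[OF Suc, of "1 / x n"]]
    by (simp add: left_diff_distrib right_diff_distrib mult_ac)
qed

text \<open>The series is \<open>w * p'(w)\<close> for the product \<open>p\<close>, evaluated by
  logarithmic differentiation; the induction on the number of factors is the product rule on
  coefficients.\<close>

lemma root_prod_log_deriv_sums:
  fixes w :: "'a::real_normed_field"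
  assumes "\<And>i. i < n \<Longrightarrow> w \<noteq> of_real (x i)" and "\<And>i. i < n \<Longrightarrow> x i \<noteq> 0"
  shows "(\<lambda>k. of_real (real k * coeff (root_prod x n) k) * w ^ k) sums
    (- (\<Prod>i<n. 1 - w / of_real (x i)) * (\<Sum>i<n. w / of_real (x i) / (1 - w / of_real (x i))))"
  using assms
proof (induction n)
  case 0
  have "(\<lambda>k. of_real (real k * coeff (root_prod x 0) k) * w ^ k) = (\<lambda>_. 0)"
    by (auto simp: fun_eq_iff)
  thus ?case by simp
next
  case (Suc n)
  define S where "S = (\<Prod>i<n. 1 - w / of_real (x i))"
  define L where "L = (\<Sum>i<n. w / of_real (x i) / (1 - w / of_real (x i)))"
  define u where "u = w / of_real (x n)"
  have "u \<noteq> 1" using Suc.prems[of n] by (auto simp: u_def)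
  have IH: "(\<lambda>k. of_real (real k * coeff (root_prod x n) k) * w ^ k) sums (- S * L)"
    using Suc by (simp add: S_def L_def)
  \<comment> \<open>Multiplication by \<open>u\<close> moves the coefficient of index
    \<open>j\<close> to index \<open>j + 1\<close>, where the Euler operator weights it by
    \<open>j + 1\<close>; hence the extra summand.\<close>
  have "(\<lambda>k. of_real (real k * coeff (root_prod x n) k + coeff (root_prod x n) k) * w ^ k)
      sums (- S * L + S)"
    using sums_add[OF IH root_prod_sums[of x n w, folded S_def]] by (simp add: algebra_simps)
  from sums_diff[OF IH sums_mult_linear_factor[OF this, of "1 / x n"]]
  have "(\<lambda>k. of_real (real k * coeff (root_prod x n) k - (case k of 0 \<Rightarrow> 0 | Suc j \<Rightarrow>
        1 / x n * (real j * coeff (root_prod x n) j + coeff (root_prod x n) j))) * w ^ k)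
      sums (- S * L - u * (- S * L + S))"
    by (simp add: algebra_simps u_def)
  moreover have "real k * coeff (root_prod x (Suc n)) k =
      real k * coeff (root_prod x n) k - (case k of 0 \<Rightarrow> 0 | Suc j \<Rightarrow>
        1 / x n * (real j * coeff (root_prod x n) j + coeff (root_prod x n) j))" for k
    by (simp add: root_prod_Suc mult.commute[of "root_prod x n"] coeff_pCons algebra_simps
        add_divide_distrib split: nat.split)
  moreover have "- S * L - u * (- S * L + S) = - (S * (1 - u)) * (L + u / (1 - u))"
    using \<open>u \<noteq> 1\<close> by (simp add: field_simps)
  ultimately show ?case by (simp add: S_def L_def u_def)
qed

text \<open>
  At \<open>w = R'\<close> the quotient \<open>B/A = 1 - m \<Sum>\<^sub>i v\<^sub>i w / (1 - v\<^sub>i w)\<close>, \<open>v\<^sub>i = 1 / x\<^sub>i\<close>, is positive;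
  scaling down to \<open>|w| \<le> R\<close> gains the factor \<open>R / R'\<close> in every summand.
\<close>
lemma root_prod_lower_bounds:
  fixes w :: complex and m :: nat
  assumes m: "m > 0" and R: "0 \<le> R" "R < R'" "norm w \<le> R"
    and y: "\<And>i. i < n \<Longrightarrow> R' < y i" "\<And>i. i < n \<Longrightarrow> y i < x i"
    and B: "\<And>k. coeff (root_prod y n) k = (1 + real m * real k) * coeff (root_prod x n) k"
  defines "A \<equiv> \<lambda>w. \<Sum>k. complex_of_real (coeff (root_prod x n) k) * w ^ k"
  defines "B \<equiv> \<lambda>w. \<Sum>k. complex_of_real (coeff (root_prod y n) k) * w ^ k"
  shows "exp (- 1) \<le> norm (A w)" and "1 - R / R' \<le> Re (B w / A w)"
proof -
  have R': "R' > 0" using R by simp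
  have x: "R' < x i" if "i < n" for i using y[OF that] by simp
  have key: "B z = A z * (1 - of_nat m * (\<Sum>i<n. z / of_real (x i) / (1 - z / of_real (x i))))"
    and Az: "A z = (\<Prod>i<n. 1 - z / of_real (x i))"
    if z: "norm z \<le> R'" for z
  proof -
    have ne: "z \<noteq> of_real (x i)" "x i \<noteq> 0" if "i < n" for i
      using x[OF that] z R' by auto
    show Az: "A z = (\<Prod>i<n. 1 - z / of_real (x i))"
      unfolding A_def by (rule sums_unique[symmetric, OF root_prod_sums])
    have "(\<lambda>k. of_real (coeff (root_prod y n) k) * z ^ k) sums
        (A z + of_nat m * (- A z * (\<Sum>i<n. z / of_real (x i) / (1 - z / of_real (x i)))))"
      using sums_add[OF root_prod_sums[of x n z, folded Az] sums_mult[OF root_prod_log_deriv_sums[of n z x, OF ne, folded Az], of "of_nat m"]]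
      by (simp add: B algebra_simps)
    thus "B z = A z * (1 - of_nat m * (\<Sum>i<n. z / of_real (x i) / (1 - z / of_real (x i))))"
      unfolding B_def by (simp add: sums_iff algebra_simps)
  qed
  define L where "L t = (\<Sum>i<n. t / x i / (1 - t / x i))" for t
  have L_le: "m * L R' < 1"
  proof -
    have "B (of_real R') = (\<Prod>i<n. 1 - of_real R' / of_real (y i))"
      unfolding B_def by (rule sums_unique[symmetric, OF root_prod_sums])
    also have "\<dots> = of_real (\<Prod>i<n. 1 - R' / y i)" by simp
    finally have Beq: "B (of_real R') = of_real (\<Prod>i<n. 1 - R' / y i)" .
    have Bp: "0 < (\<Prod>i<n. 1 - R' / y i)"
      using R' y(1) by (intro prod_pos) (force simp: field_simps)
    have Aeq: "A (of_real R') = of_real (\<Prod>i<n. 1 - R' / x i)"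
      using R' by (simp add: Az)
    have Ap: "0 < (\<Prod>i<n. 1 - R' / x i)"
      using R' x by (intro prod_pos) (force simp: field_simps)
    have "complex_of_real (\<Prod>i<n. 1 - R' / y i) = of_real ((\<Prod>i<n. 1 - R' / x i) * (1 - m * L R'))"
      using key[of "of_real R'"] R' unfolding Beq Aeq L_def by simp
    hence "(\<Prod>i<n. 1 - R' / y i) = (\<Prod>i<n. 1 - R' / x i) * (1 - m * L R')"
      by (simp only: of_real_eq_iff)
    thus ?thesis using Bp Ap by (simp add: zero_less_mult_iff)
  qed
  have term_le: "R / x i / (1 - R / x i) \<le> R / R' * (R' / x i / (1 - R' / x i))" if i: "i < n" for i
  proof -
    have "1 / (x i - R) \<le> 1 / (x i - R')" using x[OF i] R by (intro divide_left_mono) auto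
    hence "R * (1 / (x i - R)) \<le> R * (1 / (x i - R'))" using R by (intro mult_left_mono) auto
    thus ?thesis using x[OF i] R R' by (simp add: field_simps)
  qed
  have "L R \<le> R / R' * L R'"
    unfolding L_def sum_distrib_left using term_le by (intro sum_mono) auto
  hence mL: "m * L R \<le> R / R'"
  proof -
    have "m * L R \<le> m * (R / R' * L R')" using \<open>L R \<le> _\<close> by (intro mult_left_mono) auto
    also have "\<dots> = R / R' * (m * L R')" by simp
    also have "\<dots> \<le> R / R' * 1" using L_le R R' by (intro mult_left_mono) auto
    finally show ?thesis by simp
  qed
  have w: "norm w \<le> R'" using R by simp
  have fac: "1 - R / x i \<le> norm (1 - w / of_real (x i))" "0 < 1 - R / x i" if i: "i < n" for i
  proof -
    have "norm (w / of_real (x i)) \<le> R / x i"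
      using R x[OF i] R' by (simp add: norm_divide divide_right_mono)
    thus "1 - R / x i \<le> norm (1 - w / of_real (x i))"
      using norm_triangle_ineq2[of 1 "w / of_real (x i)"] by simp
    show "0 < 1 - R / x i" using x[OF i] R by (simp add: field_simps)
  qed
  \<comment> \<open>From \<open>m >= 1\<close> and \<open>m * L R <= 1\<close> one gets
    \<open>L R <= 1\<close>. The resulting bound does not depend on \<open>n\<close>, so it survives
    the limit and keeps the limit function away from zero.\<close>
  have "exp (- 1) \<le> exp (- L R)"
  proof -
    have "0 \<le> L R" unfolding L_def using R x
      by (intro sum_nonneg divide_nonneg_nonneg) (force simp: field_simps)+
    hence "L R \<le> m * L R" using m by (cases m) (auto simp: algebra_simps)
    also have "\<dots> \<le> 1" using mL R by (simp add: divide_le_eq_1 order.trans)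
    finally show ?thesis by simp
  qed
  also have "exp (- L R) = (\<Prod>i<n. exp (- (R / x i / (1 - R / x i))))"
    by (simp add: L_def exp_sum flip: sum_negf)
  also have "\<dots> \<le> (\<Prod>i<n. 1 - R / x i)"
  proof (intro prod_mono conjI)
    fix i assume "i \<in> {..<n}"
    define t where "t = 1 - R / x i"
    have t: "0 < t" using fac(2) \<open>i \<in> _\<close> by (simp add: t_def)
    \<comment> \<open>The inequality \<open>1 + s <= exp s\<close> at
      \<open>s = (1 - t) / t\<close>, then inverted.\<close>
    have "1 / t = 1 + (1 - t) / t" using t by (simp add: field_simps)
    also have "\<dots> \<le> exp ((1 - t) / t)" by (rule exp_ge_add_one_self)
    finally have "exp (- ((1 - t) / t)) \<le> t" using t by (simp add: exp_minus field_simps)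
    thus "exp (- (R / x i / (1 - R / x i))) \<le> 1 - R / x i" by (simp add: t_def)
  qed simp
  also have "\<dots> \<le> (\<Prod>i<n. norm (1 - w / of_real (x i)))"
    using fac by (intro prod_mono) (auto intro: less_imp_le)
  also have "\<dots> = norm (A w)" by (simp add: Az[OF w] prod_norm)
  finally show An: "exp (- 1) \<le> norm (A w)" .
  hence "A w \<noteq> 0" by auto
  hence "Re (B w / A w) = 1 - m * Re (\<Sum>i<n. w / of_real (x i) / (1 - w / of_real (x i)))"
    by (simp add: key[OF w])
  moreover have "Re (\<Sum>i<n. w / of_real (x i) / (1 - w / of_real (x i))) \<le> L R"
  proof -
    have "Re (\<Sum>i<n. w / of_real (x i) / (1 - w / of_real (x i)))
        \<le> (\<Sum>i<n. norm (w / of_real (x i) / (1 - w / of_real (x i))))"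
      by (rule order.trans[OF complex_Re_le_cmod norm_sum])
    also have "\<dots> \<le> L R" unfolding L_def
    proof (rule sum_mono)
      fix i assume "i \<in> {..<n}"
      hence i: "i < n" by simp
      have "norm (w / of_real (x i)) \<le> R / x i"
        using R x[OF i] R' by (simp add: norm_divide divide_right_mono)
      thus "norm (w / of_real (x i) / (1 - w / of_real (x i))) \<le> R / x i / (1 - R / x i)"
        unfolding norm_divide[of "w / of_real (x i)"]
        using fac[OF i] R x[OF i] by (intro frac_le divide_nonneg_nonneg) auto
    qed
    finally show ?thesis .
  qed
  hence "m * Re (\<Sum>i<n. w / of_real (x i) / (1 - w / of_real (x i))) \<le> m * L R"
    by (intro mult_left_mono) auto
  ultimately show "1 - R / R' \<le> Re (B w / A w)" using mL by linarith
qed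

subsection \<open>Entire power series and the convexity condition\<close>

definition powser :: "(nat \<Rightarrow> real) \<Rightarrow> complex \<Rightarrow> complex" where
  "powser a w = (\<Sum>k. of_real (a k) * w ^ k)"

definition entire_coeffs :: "(nat \<Rightarrow> real) \<Rightarrow> bool" where
  "entire_coeffs a \<longleftrightarrow> (\<forall>r. summable (\<lambda>k. a k * r ^ k))"

lemma entire_coeffs_summable_norm:
  assumes "entire_coeffs a"
  shows "summable (\<lambda>k. norm (of_real (a k) * w ^ k :: complex))"
proof -
  have "summable (\<lambda>k. norm (a k * norm w ^ k))"
    by (rule powser_insidea[where x = "norm w + 1"]) (use assms in \<open>auto simp: entire_coeffs_def\<close>)
  thus ?thesis by (simp add: norm_mult norm_power abs_mult)
qed

lemma entire_coeffs_abs: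
  assumes "entire_coeffs a" and "\<And>k. \<bar>b k\<bar> = \<bar>a k\<bar>"
  shows "entire_coeffs b"
  unfolding entire_coeffs_def
proof
  fix r
  show "summable (\<lambda>k. b k * r ^ k)"
    using entire_coeffs_summable_norm[OF assms(1), of "of_real r"]
    by (intro summable_norm_cancel[of "\<lambda>k. b k * r ^ k"])
       (simp add: norm_mult norm_power abs_mult assms(2) power_abs)
qed

lemma powser_summable: "entire_coeffs a \<Longrightarrow> summable (\<lambda>k. of_real (a k) * w ^ k :: complex)"
  by (rule summable_norm_cancel) (rule entire_coeffs_summable_norm)

lemma entire_coeffs_of_nat_mult:
  assumes "entire_coeffs a"
  shows "entire_coeffs (\<lambda>k. real k * a k)"
  unfolding entire_coeffs_def
proof
  fix r
  have "summable (\<lambda>k. diffs a k * r ^ k)"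
    using assms by (intro termdiff_converges_all) (simp add: entire_coeffs_def)
  hence "summable (\<lambda>k. r * (diffs a k * r ^ k))" by (rule summable_mult)
  thus "summable (\<lambda>k. real k * a k * r ^ k)"
    by (subst summable_Suc_iff[symmetric]) (simp add: diffs_def mult_ac)
qed

lemma entire_coeffs_linear_mult:
  assumes "entire_coeffs a"
  shows "entire_coeffs (\<lambda>k. (1 + real m * real k) * a k)"
  unfolding entire_coeffs_def
proof
  fix r
  have "summable (\<lambda>k. a k * r ^ k)" "summable (\<lambda>k. real k * a k * r ^ k)"
    using assms entire_coeffs_of_nat_mult[OF assms] by (simp_all add: entire_coeffs_def)
  hence "summable (\<lambda>k. a k * r ^ k + real m * (real k * a k * r ^ k))"
    by (intro summable_add summable_mult)
  thus "summable (\<lambda>k. (1 + real m * real k) * a k * r ^ k)"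
    by (simp add: algebra_simps)
qed

lemma powser_linear_mult:
  assumes "entire_coeffs a"
  shows "powser (\<lambda>k. (1 + real m * real k) * a k) w = powser a w + of_nat m * powser (\<lambda>k. real k * a k) w"
proof -
  have "(\<lambda>k. of_real (a k) * w ^ k + of_nat m * (of_real (real k * a k) * w ^ k))
      sums (powser a w + of_nat m * powser (\<lambda>k. real k * a k) w)"
    unfolding powser_def
    by (intro sums_add sums_mult summable_sums powser_summable entire_coeffs_of_nat_mult assms)
  thus ?thesis unfolding powser_def by (simp add: sums_iff algebra_simps)
qed

text \<open>The derivative is described through \<open>w * D\<close> because the Euler operator acts
  diagonally on coefficients, without an index shift.\<close>

lemma powser_has_deriv:
  assumes "entire_coeffs a"
  obtains D where "(powser a has_field_derivative D) (at w)"
    and "w * D = powser (\<lambda>k. real k * a k) w"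
proof
  let ?c = "\<lambda>k. complex_of_real (a k)"
  show "(powser a has_field_derivative (\<Sum>k. diffs ?c k * w ^ k)) (at w)"
    unfolding powser_def[abs_def]
    by (rule termdiffs_strong_converges_everywhere) (rule powser_summable[OF assms])
  have "summable (\<lambda>k. diffs ?c k * w ^ k)"
    by (rule termdiff_converges_all) (rule powser_summable[OF assms])
  hence "(\<lambda>k. w * (diffs ?c k * w ^ k)) sums (w * (\<Sum>k. diffs ?c k * w ^ k))"
    by (intro sums_mult summable_sums)
  hence "(\<lambda>k. of_real (real k * a k) * w ^ k) sums (w * (\<Sum>k. diffs ?c k * w ^ k))"
    using sums_Suc[of "\<lambda>k. of_real (real k * a k) * w ^ k"] by (simp add: diffs_def mult_ac)
  thus "w * (\<Sum>k. diffs ?c k * w ^ k) = powser (\<lambda>k. real k * a k) w"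
    unfolding powser_def by (simp add: sums_iff)
qed

lemma powser_compose_power_deriv:
  assumes "entire_coeffs a" and "m > 0"
  shows "\<exists>D. ((\<lambda>z. powser a (z ^ m)) has_field_derivative D) (at z) \<and>
    z * D = of_nat m * powser (\<lambda>k. real k * a k) (z ^ m)"
proof -
  obtain D where D: "(powser a has_field_derivative D) (at (z ^ m))"
    and zD: "z ^ m * D = powser (\<lambda>k. real k * a k) (z ^ m)"
    by (rule powser_has_deriv[OF assms(1)])
  have "((\<lambda>z. z ^ m) has_field_derivative of_nat m * z ^ (m - 1)) (at z)"
    by (auto intro!: derivative_eq_intros)
  from DERIV_chain2[OF D this]
  have "((\<lambda>z. powser a (z ^ m)) has_field_derivative D * (of_nat m * z ^ (m - 1))) (at z)" .
  moreover have "z * (D * (of_nat m * z ^ (m - 1))) = of_nat m * (z ^ m * D)"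
    using \<open>m > 0\<close> by (cases m) simp_all
  ultimately show ?thesis using zD by metis
qed

text \<open>Differentiating \<open>z * F(z ^ m)\<close> multiplies the coefficient of index
  \<open>k\<close> of \<open>F\<close> by \<open>1 + m * k\<close>. Since
  \<open>f' + z * f''\<close> is the derivative of \<open>z * f'\<close>, the second identity
  applies the same weight once more.\<close>

lemma
  assumes a: "entire_coeffs a" and m: "m > 0"
  defines "f \<equiv> \<lambda>z. z * powser a (z ^ m)"
  shows deriv_mult_powser: "deriv f z = powser (\<lambda>k. (1 + real m * real k) * a k) (z ^ m)"
    and deriv2_mult_powser: "deriv f z + z * deriv (deriv f) z =
      powser (\<lambda>k. (1 + real m * real k) ^ 2 * a k) (z ^ m)"
proof -
  have d1: "deriv f z = powser (\<lambda>k. (1 + real m * real k) * a k) (z ^ m)" for z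
  proof -
    obtain D where D: "((\<lambda>z. powser a (z ^ m)) has_field_derivative D) (at z)"
      and zD: "z * D = of_nat m * powser (\<lambda>k. real k * a k) (z ^ m)"
      using powser_compose_power_deriv[OF a m] by blast
    have "(f has_field_derivative powser a (z ^ m) + z * D) (at z)"
      unfolding f_def by (rule derivative_eq_intros D refl)+ (simp add: algebra_simps)
    thus ?thesis by (simp add: DERIV_imp_deriv zD powser_linear_mult[OF a])
  qed
  thus "deriv f z = powser (\<lambda>k. (1 + real m * real k) * a k) (z ^ m)" .
  have a': "entire_coeffs (\<lambda>k. (1 + real m * real k) * a k)"
    by (rule entire_coeffs_linear_mult[OF a])
  obtain D where D: "((\<lambda>z. powser (\<lambda>k. (1 + real m * real k) * a k) (z ^ m)) has_field_derivative D) (at z)"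
    and zD: "z * D = of_nat m * powser (\<lambda>k. real k * ((1 + real m * real k) * a k)) (z ^ m)"
    using powser_compose_power_deriv[OF a' m] by blast
  have "deriv f = (\<lambda>z. powser (\<lambda>k. (1 + real m * real k) * a k) (z ^ m))"
    using d1 by blast
  with D have "deriv (deriv f) z = D" by (simp add: DERIV_imp_deriv)
  thus "deriv f z + z * deriv (deriv f) z = powser (\<lambda>k. (1 + real m * real k) ^ 2 * a k) (z ^ m)"
    using powser_linear_mult[OF a', of m "z ^ m"] zD
    by (simp add: d1 power2_eq_square mult.assoc)
qed

text \<open>The map \<open>z \<mapsto> z ^ m\<close> sends the disc of radius \<open>r\<close> onto
  the disc of radius \<open>r ^ m\<close>; surjectivity uses a complex \<open>m\<close>-th
  root.\<close>

lemma convexity_condition_iff: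
  assumes a: "entire_coeffs a" and m: "m > 0" and r: "r > 0"
  defines "f \<equiv> \<lambda>z. z * powser a (z ^ m)"
  defines "A \<equiv> powser (\<lambda>k. (1 + real m * real k) * a k)"
    and "B \<equiv> powser (\<lambda>k. (1 + real m * real k) ^ 2 * a k)"
  shows "(\<forall>z\<in>ball 0 r. deriv f z \<noteq> 0 \<and> Re (1 + z * deriv (deriv f) z / deriv f z) > 0) \<longleftrightarrow>
    (\<forall>w\<in>ball 0 (r ^ m). A w \<noteq> 0 \<and> Re (B w / A w) > 0)" (is "?L \<longleftrightarrow> ?R")
proof -
  have eq: "deriv f z \<noteq> 0 \<and> Re (1 + z * deriv (deriv f) z / deriv f z) > 0 \<longleftrightarrow>
      A (z ^ m) \<noteq> 0 \<and> Re (B (z ^ m) / A (z ^ m)) > 0" for z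
  proof -
    have A: "deriv f z = A (z ^ m)"
      unfolding f_def A_def by (rule deriv_mult_powser[OF a m])
    have B: "deriv f z + z * deriv (deriv f) z = B (z ^ m)"
      unfolding f_def B_def by (rule deriv2_mult_powser[OF a m])
    show ?thesis
    proof (cases "A (z ^ m) = 0")
      case False
      have "1 + z * deriv (deriv f) z / deriv f z = B (z ^ m) / A (z ^ m)"
        unfolding B[symmetric] A[symmetric] using False A by (simp add: add_divide_distrib)
      thus ?thesis by (simp only: A)
    qed (simp add: A)
  qed
  show ?thesis
  proof
    assume ?L
    show ?R
    proof
      fix w :: complex assume w: "w \<in> ball 0 (r ^ m)"
      define z where "z = w powr (1 / of_nat m)"
      have zw: "z ^ m = w"
      proof (cases "w = 0")
        case False
        have "z = exp (Ln w / of_nat m)" using False by (simp add: z_def powr_def)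
        hence "z ^ m = exp (of_nat m * (Ln w / of_nat m))" by (simp only: exp_of_nat_mult)
        also have "of_nat m * (Ln w / of_nat m) = Ln w" using m by simp
        finally show ?thesis using False by simp
      qed (use m in \<open>simp add: z_def\<close>)
      have "norm z ^ m = norm w" unfolding zw[symmetric] by (rule norm_power[symmetric])
      also have "norm w < r ^ m" using w by simp
      finally have "norm z < r" by (rule power_less_imp_less_base) (use r in simp)
      hence "z \<in> ball 0 r" by simp
      hence "A (z ^ m) \<noteq> 0 \<and> Re (B (z ^ m) / A (z ^ m)) > 0"
        using \<open>?L\<close> eq by blast
      thus "A w \<noteq> 0 \<and> Re (B w / A w) > 0" unfolding zw .
    qed
  next
    assume ?R
    show ?L
    proof
      fix z :: complex assume "z \<in> ball 0 r"
      hence "z ^ m \<in> ball 0 (r ^ m)" using m by (simp add: norm_power power_strict_mono)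
      thus "deriv f z \<noteq> 0 \<and> Re (1 + z * deriv (deriv f) z / deriv f z) > 0"
        unfolding eq using \<open>?R\<close> by (rule bspec[rotated])
    qed
  qed
qed

section \<open>Convergence of power series with dominated coefficients\<close>

lemma powser_tendsto:
  assumes M: "entire_coeffs M" and "\<And>N k. \<bar>a N k\<bar> \<le> M k"
    and "\<And>k. (\<lambda>N. a N k) \<longlonglongrightarrow> b k"
  shows "(\<lambda>N. powser (a N) w) \<longlonglongrightarrow> powser b w"
proof -
  have "summable (\<lambda>k. M k * norm w ^ k)" using M by (simp add: entire_coeffs_def)
  moreover have "\<forall>\<^sub>F (k, N) in at_top \<times>\<^sub>F sequentially.
      norm (complex_of_real (a N k) * w ^ k) \<le> M k * norm w ^ k"
    using assms(2) by (intro always_eventually) (auto simp: norm_mult norm_power intro!: mult_right_mono)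
  ultimately show ?thesis unfolding powser_def
    by (intro tannerys_theorem[THEN conjunct2, THEN conjunct2]) (auto intro!: tendsto_intros assms(3))
qed

text \<open>This weighted distance of coefficients bounds the distance of the functions on the whole
  disc of radius \<open>r\<close>. Uniformity is needed because the approximants will be evaluated
  at their own roots, which move with \<open>N\<close>.\<close>

lemma coeff_dist_tendsto_0:
  assumes M: "entire_coeffs M" and "\<And>N k. \<bar>a N k\<bar> \<le> M k"
    and lim: "\<And>k. (\<lambda>N. a N k) \<longlonglongrightarrow> b k" and "r \<ge> 0"
  shows "(\<lambda>N. \<Sum>k. \<bar>a N k - b k\<bar> * r ^ k) \<longlonglongrightarrow> 0"
proof -
  have b: "\<bar>b k\<bar> \<le> M k" for k
    by (rule tendsto_upperbound[OF tendsto_rabs[OF lim]]) (use assms(2) in auto)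
  have "summable (\<lambda>k. 2 * (M k * r ^ k))" using M by (simp add: entire_coeffs_def)
  moreover have "norm (\<bar>a N k - b k\<bar> * r ^ k) \<le> 2 * (M k * r ^ k)" for N k
  proof -
    have "\<bar>a N k - b k\<bar> \<le> 2 * M k" using assms(2)[of N k] b[of k] by linarith
    hence "\<bar>a N k - b k\<bar> * r ^ k \<le> 2 * M k * r ^ k" using \<open>r \<ge> 0\<close> by (intro mult_right_mono) auto
    thus ?thesis using \<open>r \<ge> 0\<close> by simp
  qed
  moreover have "(\<lambda>N. \<bar>a N k - b k\<bar> * r ^ k) \<longlonglongrightarrow> 0" for k
    by (rule tendsto_mult_left_zero[OF tendsto_rabs_zero[OF LIM_zero[OF lim]]])
  moreover from calculation(2) have "\<forall>\<^sub>F (k, N) in at_top \<times>\<^sub>F sequentially.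
      norm (\<bar>a N k - b k\<bar> * r ^ k) \<le> 2 * (M k * r ^ k)"
    by (intro always_eventually allI) (simp only: case_prod_beta)
  ultimately have "(\<lambda>N. \<Sum>k. \<bar>a N k - b k\<bar> * r ^ k) \<longlonglongrightarrow> (\<Sum>k. 0 :: real)"
    by (intro tannerys_theorem[where M = "\<lambda>k. 2 * (M k * r ^ k)", THEN conjunct2, THEN conjunct2]
        trivial_limit_sequentially)
  thus ?thesis by simp
qed

lemma powser_dist_le:
  assumes M: "entire_coeffs M" and a: "\<And>k. \<bar>a k\<bar> \<le> M k" and b: "\<And>k. \<bar>b k\<bar> \<le> M k" and w: "norm w \<le> r"
  shows "norm (powser a w - powser b w) \<le> (\<Sum>k. \<bar>a k - b k\<bar> * r ^ k)"
proof -
  have r: "r \<ge> 0" using norm_ge_zero[of w] w by linarith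
  have sM: "summable (\<lambda>k. M k * r ^ k)" for r using M by (simp add: entire_coeffs_def)
  have sa: "summable (\<lambda>k. complex_of_real (a k) * w ^ k)"
    by (rule summable_comparison_test'[OF sM[of "norm w"]])
       (use a in \<open>auto simp: norm_mult norm_power intro!: mult_right_mono\<close>)
  have sb: "summable (\<lambda>k. complex_of_real (b k) * w ^ k)"
    by (rule summable_comparison_test'[OF sM[of "norm w"]])
       (use b in \<open>auto simp: norm_mult norm_power intro!: mult_right_mono\<close>)
  have le: "norm (of_real (a k) * w ^ k - of_real (b k) * w ^ k) \<le> \<bar>a k - b k\<bar> * r ^ k" for k
  proof -
    have "of_real (a k) * w ^ k - of_real (b k) * w ^ k = of_real (a k - b k) * w ^ k"
      by (simp add: left_diff_distrib)
    thus ?thesis using w by (auto simp only: norm_mult norm_power norm_of_real intro!: mult_left_mono power_mono norm_ge_zero)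
  qed
  have s: "summable (\<lambda>k. \<bar>a k - b k\<bar> * r ^ k)"
  proof (rule summable_comparison_test'[OF summable_mult[OF sM[of r], of 2]])
    fix k
    have "\<bar>a k - b k\<bar> \<le> 2 * M k" using a[of k] b[of k] by linarith
    hence "\<bar>a k - b k\<bar> * r ^ k \<le> 2 * M k * r ^ k" using \<open>r \<ge> 0\<close> by (intro mult_right_mono) auto
    thus "norm (\<bar>a k - b k\<bar> * r ^ k) \<le> 2 * (M k * r ^ k)" using r by simp
  qed
  have "powser a w - powser b w = (\<Sum>k. of_real (a k) * w ^ k - of_real (b k) * w ^ k)"
    unfolding powser_def by (rule suminf_diff[OF sa sb])
  also have "norm \<dots> \<le> (\<Sum>k. \<bar>a k - b k\<bar> * r ^ k)"
  proof (rule order.trans[OF summable_norm suminf_le])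
    show "summable (\<lambda>k. norm (of_real (a k) * w ^ k - of_real (b k) * w ^ k))"
      by (rule summable_comparison_test'[OF s]) (use le in auto)
    thus "summable (\<lambda>k. norm (of_real (a k) * w ^ k - of_real (b k) * w ^ k))" .
  qed (use le s in auto)
  finally show ?thesis .
qed

subsection \<open>Limits of real-rooted polynomials\<close>

text \<open>The bound by \<open>c\<close> itself is the majorant for dominated convergence. The
  signs are kept out of \<open>c\<close>, whose entries are positive.\<close>

locale real_rooted_limit =
  fixes c :: "nat \<Rightarrow> real" and x :: "nat \<Rightarrow> nat \<Rightarrow> real" and d :: "nat \<Rightarrow> nat"
  assumes c_0: "c 0 = 1" and c_pos: "\<And>k. 0 < c k" and entire_c: "entire_coeffs c"
    and x_mono: "\<And>N. strict_mono_on {..<d N} (x N)"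
    and x_pos: "\<And>N i. i < d N \<Longrightarrow> 0 < x N i"
    and coeff_bound: "\<And>N k. \<bar>coeff (root_prod (x N) (d N)) k\<bar> \<le> c k"
    and coeff_lim: "\<And>k. (\<lambda>N. coeff (root_prod (x N) (d N)) k) \<longlonglongrightarrow> (- 1) ^ k * c k"
begin

context
  fixes m :: nat
  assumes m: "m > 0"
begin

text \<open>\<open>e k\<close> is the limit of the \<open>k\<close>-th elementary symmetric
  functions of the reciprocal roots of the polynomials approximating \<open>B\<close>.\<close>

definition "e k = (1 + real m * real k) ^ 2 * c k"
definition "A = powser (\<lambda>k. (1 + real m * real k) * ((- 1) ^ k * c k))"
definition "B = powser (\<lambda>k. (1 + real m * real k) ^ 2 * ((- 1) ^ k * c k))"

text \<open>Two applications of the Rolle argument to each approximant: \<open>y N\<close> are the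
  roots of the polynomial approximating \<open>A\<close>, and \<open>z N\<close> those of the one
  approximating \<open>B\<close>.\<close>

lemma derived_roots:
  obtains y z where
    "\<And>N i. i < d N \<Longrightarrow> 0 < z N i"
    "\<And>N i. i < d N \<Longrightarrow> z N i < y N i"
    "\<And>N k. coeff (root_prod (y N) (d N)) k = (1 + real m * real k) * coeff (root_prod (x N) (d N)) k"
    "\<And>N k. coeff (root_prod (z N) (d N)) k = (1 + real m * real k) ^ 2 * coeff (root_prod (x N) (d N)) k"
proof -
  have coeff: "coeff (p + smult (of_nat m) (pCons 0 (pderiv p))) k = (1 + real m * real k) * coeff p k"
    for p :: "real poly" and k
    by (cases k) (simp_all add: coeff_pderiv algebra_simps)
  define Q where "Q N y z \<longleftrightarrow> (\<forall>i<d N. 0 < z i \<and> z i < y i) \<and>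
      (\<forall>k. coeff (root_prod y (d N)) k = (1 + real m * real k) * coeff (root_prod (x N) (d N)) k) \<and>
      (\<forall>k. coeff (root_prod z (d N)) k = (1 + real m * real k) ^ 2 * coeff (root_prod (x N) (d N)) k)"
    for N y z
  have "\<forall>N. \<exists>y z. Q N y z"
  proof
    fix N
    obtain y where y: "strict_mono_on {..<d N} y" "\<And>i. i < d N \<Longrightarrow> 0 < y i \<and> y i < x N i"
      "root_prod (x N) (d N) + smult (of_nat m) (pCons 0 (pderiv (root_prod (x N) (d N)))) = root_prod y (d N)"
      by (rule euler_operator_root_prod[OF x_mono[of N] x_pos[of _ N] m]) (assumption | rule that; blast)+
    have "0 < y i" if "i < d N" for i using y(2)[OF that] by simp
    then obtain z where z: "\<And>i. i < d N \<Longrightarrow> 0 < z i \<and> z i < y i"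
      "root_prod y (d N) + smult (of_nat m) (pCons 0 (pderiv (root_prod y (d N)))) = root_prod z (d N)"
      by (rule euler_operator_root_prod[OF y(1) _ m]) (assumption | rule that; blast)+
    have "coeff (root_prod y (d N)) k = (1 + real m * real k) * coeff (root_prod (x N) (d N)) k" for k
      unfolding y(3)[symmetric] coeff ..
    moreover have "coeff (root_prod z (d N)) k = (1 + real m * real k) * coeff (root_prod y (d N)) k" for k
      unfolding z(2)[symmetric] coeff ..
    ultimately have "Q N y z" using z(1) by (simp add: Q_def power2_eq_square)
    thus "\<exists>y z. Q N y z" by blast
  qed
  from choice[OF this] obtain y where "\<forall>N. \<exists>z. Q N (y N) z" ..
  from choice[OF this] obtain z where "\<forall>N. Q N (y N) (z N)" ..
  thus thesis by (intro that[of z y]) (simp_all add: Q_def)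
qed

lemma entire_c1: "entire_coeffs (\<lambda>k. (1 + real m * real k) * c k)"
  by (rule entire_coeffs_linear_mult[OF entire_c])

lemma entire_e: "entire_coeffs e"
  using entire_coeffs_linear_mult[OF entire_c1, of m]
  by (simp add: e_def[abs_def] power2_eq_square mult.assoc)

lemma e_pos: "0 < e k"
  unfolding e_def using c_pos by (intro mult_pos_pos zero_less_power add_pos_nonneg) auto

context
  assumes e_1_2: "4 * e 2 \<le> e 1 ^ 2"
begin

text \<open>Newton's expressions for the power sums of order one, two and three in terms of
  elementary symmetric functions.\<close>

definition "s1 = e 1"
definition "s2 = e 1 ^ 2 - 2 * e 2"
definition "s3 = e 1 ^ 3 - 3 * e 1 * e 2 + 3 * e 3"

text \<open>For finitely many roots \<open>s2 ^ 2 <= s1 * s3\<close> is the Cauchy-Schwarz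
  inequality, but a limit would preserve it only weakly. Strictness comes from the explicit form of
  the difference, whose last summand \<open>3 * e 1 * e 3\<close> is positive.\<close>

lemma s_pos: "0 < s1" "0 < s2" "0 < s3" and s_less: "s2 < s1 ^ 2" "s2 ^ 2 < s1 * s3"
proof -
  note e_pos[of 1] e_pos[of 2] e_pos[of 3]
  thus "0 < s1" "0 < s2" "s2 < s1 ^ 2" using e_1_2 by (simp_all add: s1_def s2_def)
  have "s1 * s3 - s2 ^ 2 = e 2 * (e 1 ^ 2 - 4 * e 2) + 3 * (e 1 * e 3)"
    unfolding s1_def s2_def s3_def by algebra
  moreover have "0 \<le> e 2 * (e 1 ^ 2 - 4 * e 2)" using e_1_2 e_pos[of 2] by simp
  moreover have "0 < e 1 * e 3" using e_pos by simp
  ultimately show *: "s2 ^ 2 < s1 * s3" by linarith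
  hence "0 < s1 * s3" using zero_le_power2[of s2] by linarith
  thus "0 < s3" using \<open>0 < s1\<close> by (simp add: zero_less_mult_iff)
qed

text \<open>These power sums are polynomials in the first three coefficients, so they converge
  whatever the number of roots does.\<close>

lemma newton_sums_tendsto:
  assumes z: "\<And>N k. coeff (root_prod (z N) (d N)) k = (1 + real m * real k) ^ 2 * coeff (root_prod (x N) (d N)) k"
  shows "(\<lambda>N. \<Sum>i<d N. (1 / z N i) ^ 2) \<longlonglongrightarrow> s2" "(\<lambda>N. \<Sum>i<d N. (1 / z N i) ^ 3) \<longlonglongrightarrow> s3"
proof -
  define S where "S j N = (\<Sum>i<d N. (1 / z N i) ^ j)" for j N
  define E where "E k N = coeff (root_prod (z N) (d N)) k" for k N
  have E: "E k \<longlonglongrightarrow> (- 1) ^ k * e k" for k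
  proof -
    have "(- 1) ^ k * e k = (1 + real m * real k) ^ 2 * ((- 1) ^ k * c k)" by (simp add: e_def)
    thus ?thesis unfolding E_def z by (simp only: tendsto_mult[OF tendsto_const coeff_lim])
  qed
  have N: "E 1 N = - S 1 N" "2 * E 2 N = S 1 N ^ 2 - S 2 N"
    "6 * E 3 N = - (S 1 N ^ 3 - 3 * S 1 N * S 2 N + 2 * S 3 N)" for N
    unfolding E_def S_def by (rule newton_sums_root_prod)+
  have S2: "S 2 = (\<lambda>N. E 1 N ^ 2 - 2 * E 2 N)" using N(1,2) by (simp add: fun_eq_iff)
  have S3: "S 3 = (\<lambda>N. - (E 1 N ^ 3) + 3 * E 1 N * E 2 N - 3 * E 3 N)"
  proof
    fix N
    show "S 3 N = - (E 1 N ^ 3) + 3 * E 1 N * E 2 N - 3 * E 3 N"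
      using N[of N] by algebra
  qed
  have "S 2 \<longlonglongrightarrow> ((- 1) ^ 1 * e 1) ^ 2 - 2 * ((- 1) ^ 2 * e 2)"
    unfolding S2 by (intro tendsto_intros E)
  thus "(\<lambda>N. \<Sum>i<d N. (1 / z N i) ^ 2) \<longlonglongrightarrow> s2"
    unfolding S_def[abs_def] s2_def by simp
  have "S 3 \<longlonglongrightarrow> - (((- 1) ^ 1 * e 1) ^ 3) + 3 * ((- 1) ^ 1 * e 1) * ((- 1) ^ 2 * e 2) - 3 * ((- 1) ^ 3 * e 3)"
    unfolding S3 by (intro tendsto_intros E)
  thus "(\<lambda>N. \<Sum>i<d N. (1 / z N i) ^ 3) \<longlonglongrightarrow> s3"
    unfolding S_def[abs_def] s3_def by (simp add: algebra_simps power3_eq_cube)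
qed

text \<open>If \<open>R' ^ 2\<close> times the sum of the squared reciprocal roots is below
  \<open>1\<close>, then so is each single term, and every root \<open>z N i\<close> exceeds
  \<open>R'\<close>. The gap between \<open>R\<close> and \<open>R'\<close> leaves the margin
  \<open>1 - R / R'\<close>, which keeps the inequality strict in the limit.\<close>

lemma convex_below:
  assumes R: "0 < R" "R < R'" and R': "R' ^ 2 * s2 < 1" and w: "norm w \<le> R"
  shows "A w \<noteq> 0 \<and> Re (B w / A w) > 0"
proof -
  obtain y z where z: "\<And>N i. i < d N \<Longrightarrow> 0 < z N i" "\<And>N i. i < d N \<Longrightarrow> z N i < y N i" and
    coeffs: "\<And>N k. coeff (root_prod (y N) (d N)) k = (1 + real m * real k) * coeff (root_prod (x N) (d N)) k"
    "\<And>N k. coeff (root_prod (z N) (d N)) k = (1 + real m * real k) ^ 2 * coeff (root_prod (x N) (d N)) k"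
    by (rule derived_roots) (rule that; blast)
  have yz: "coeff (root_prod (z N) (d N)) k = (1 + real m * real k) * coeff (root_prod (y N) (d N)) k" for N k
    by (simp add: coeffs power2_eq_square)
  define AN where "AN N = powser (coeff (root_prod (y N) (d N)))" for N
  define BN where "BN N = powser (coeff (root_prod (z N) (d N)))" for N
  have AN: "(\<lambda>N. AN N w) \<longlonglongrightarrow> A w" unfolding AN_def A_def
    by (rule powser_tendsto[OF entire_c1])
       (auto simp: coeffs abs_mult intro!: mult_left_mono coeff_bound tendsto_intros coeff_lim)
  have BN: "(\<lambda>N. BN N w) \<longlonglongrightarrow> B w" unfolding BN_def B_def
    by (rule powser_tendsto[OF entire_e])
       (auto simp: e_def coeffs abs_mult intro!: mult_left_mono coeff_bound tendsto_intros coeff_lim)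
  have "\<forall>\<^sub>F N in sequentially. R' ^ 2 * (\<Sum>i<d N. (1 / z N i) ^ 2) < 1"
    by (rule order_tendstoD(2)[OF tendsto_mult[OF tendsto_const newton_sums_tendsto(1)[OF coeffs(2)]] R'])
  hence ev: "\<forall>\<^sub>F N in sequentially. exp (- 1) \<le> norm (AN N w) \<and> 1 - R / R' \<le> Re (BN N w / AN N w)"
  proof eventually_elim
    case (elim N)
    have "R' < z N i" if i: "i < d N" for i
    proof -
      have "(1 / z N i) ^ 2 \<le> (\<Sum>i<d N. (1 / z N i) ^ 2)"
        using i by (intro member_le_sum) auto
      hence "R' ^ 2 * (1 / z N i) ^ 2 \<le> R' ^ 2 * (\<Sum>i<d N. (1 / z N i) ^ 2)"
        by (intro mult_left_mono) auto
      hence "(R' * (1 / z N i)) ^ 2 < 1 ^ 2" using elim by (simp add: power_divide)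
      hence "R' * (1 / z N i) < 1" by (rule power_less_imp_less_base) simp
      thus ?thesis using z(1)[OF i] by (simp add: field_simps)
    qed
    thus ?case
      using root_prod_lower_bounds[OF m, of R R' w "d N" "z N" "y N"] R w yz z(2)
      unfolding AN_def BN_def powser_def by auto
  qed
  \<comment> \<open>This comes first because the quotients converge only once the limit of the
    denominators is known to be nonzero.\<close>
  have "exp (- 1) \<le> norm (A w)"
    by (rule tendsto_lowerbound[OF tendsto_norm[OF AN]]) (use ev in \<open>auto elim: eventually_mono\<close>)
  hence "A w \<noteq> 0" by auto
  hence "(\<lambda>N. Re (BN N w / AN N w)) \<longlonglongrightarrow> Re (B w / A w)"
    by (intro tendsto_intros AN BN)
  hence "1 - R / R' \<le> Re (B w / A w)"
    by (rule tendsto_lowerbound) (use ev in \<open>auto elim: eventually_mono\<close>)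
  moreover have "R / R' < 1" using R by simp
  ultimately show ?thesis using \<open>A w \<noteq> 0\<close> by simp
qed

lemma B_of_real: "B (of_real t) = of_real (\<Sum>k. (1 + real m * real k) ^ 2 * ((- 1) ^ k * c k) * t ^ k)"
proof -
  have "entire_coeffs (\<lambda>k. (1 + real m * real k) ^ 2 * ((- 1) ^ k * c k))"
    using entire_coeffs_abs[OF entire_e] by (auto simp: e_def abs_mult)
  hence "summable (\<lambda>k. (1 + real m * real k) ^ 2 * ((- 1) ^ k * c k) * t ^ k)"
    by (simp add: entire_coeffs_def)
  hence "complex_of_real (\<Sum>k. (1 + real m * real k) ^ 2 * ((- 1) ^ k * c k) * t ^ k) =
      (\<Sum>k. of_real ((1 + real m * real k) ^ 2 * ((- 1) ^ k * c k) * t ^ k))"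
    by (rule suminf_of_real)
  thus ?thesis by (simp add: B_def powser_def)
qed

text \<open>At a zero of \<open>B\<close> the real part of \<open>B / A\<close> cannot be positive.
  The zero is found by a real-variable form of Hurwitz's argument: otherwise \<open>B\<close> has a
  positive minimum on \<open>[0, T]\<close>, while approximants arbitrarily close to
  \<open>B\<close> vanish somewhere in that interval.\<close>

lemma not_convex_above:
  assumes R: "s2 / s3 < R"
  shows "\<exists>w. norm w < R \<and> B w = 0"
proof (rule ccontr)
  assume no_root: "\<nexists>w. norm w < R \<and> B w = 0"
  \<comment> \<open>Stopping short of \<open>R\<close> gives a compact interval inside the open disc
    on which \<open>B\<close> is assumed to have no zero.\<close>
  obtain T where T: "s2 / s3 < T" "T < R" using dense[OF R] by blast
  have T0: "0 < T" using T(1) s_pos by (smt (verit) divide_pos_pos)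
  define b where "b k = (1 + real m * real k) ^ 2 * ((- 1) ^ k * c k)" for k
  define Br where "Br t = (\<Sum>k. b k * t ^ k)" for t
  have B_eq: "B (of_real t) = of_real (Br t)" for t
    unfolding Br_def b_def by (rule B_of_real)
  have abs_b: "\<bar>b k\<bar> = \<bar>e k\<bar>" for k by (simp add: b_def e_def abs_mult)
  have "entire_coeffs b" by (rule entire_coeffs_abs[OF entire_e abs_b])
  hence "(Br has_field_derivative (\<Sum>k. diffs b k * t ^ k)) (at t)" for t
    unfolding Br_def[abs_def] by (intro termdiffs_strong_converges_everywhere) (auto simp: entire_coeffs_def)
  hence cont: "continuous_on S Br" for S
    by (meson DERIV_isCont continuous_at_imp_continuous_on)
  have Br_nz: "Br t \<noteq> 0" if "0 \<le> t" "t \<le> T" for t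
  proof
    assume "Br t = 0"
    hence "B (of_real t) = 0" by (simp add: B_eq)
    thus False using no_root that T by (auto dest: spec[of _ "of_real t"])
  qed
  have "Br 0 = 1" using powser_sums_zero[of b] by (simp add: Br_def sums_iff b_def c_0)
  have Br_pos: "0 < Br t" if "t \<in> {0..T}" for t
  proof (rule ccontr)
    assume "\<not> 0 < Br t"
    hence "\<exists>u\<ge>0. u \<le> t \<and> Br u = 0"
      using that \<open>Br 0 = 1\<close> by (intro IVT2' cont) auto
    thus False using Br_nz that by auto
  qed
  obtain t0 where t0: "t0 \<in> {0..T}" "\<And>t. t \<in> {0..T} \<Longrightarrow> Br t0 \<le> Br t"
    using continuous_attains_inf[of "{0..T}" Br] cont T0 by auto
  obtain y z where z: "\<And>N i. i < d N \<Longrightarrow> 0 < z N i" "\<And>N i. i < d N \<Longrightarrow> z N i < y N i" and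
    coeffs: "\<And>N k. coeff (root_prod (y N) (d N)) k = (1 + real m * real k) * coeff (root_prod (x N) (d N)) k"
    "\<And>N k. coeff (root_prod (z N) (d N)) k = (1 + real m * real k) ^ 2 * coeff (root_prod (x N) (d N)) k"
    by (rule derived_roots) (rule that; blast)
  define bN where "bN N = coeff (root_prod (z N) (d N))" for N
  have bN: "\<bar>bN N k\<bar> \<le> e k" for N k
    by (auto simp: bN_def e_def coeffs abs_mult intro!: mult_left_mono coeff_bound)
  have "(\<lambda>N. \<Sum>k. \<bar>bN N k - b k\<bar> * T ^ k) \<longlonglongrightarrow> 0"
    by (rule coeff_dist_tendsto_0[OF entire_e bN])
       (use T0 in \<open>auto simp: bN_def b_def coeffs intro!: tendsto_intros coeff_lim\<close>)
  hence ev1: "\<forall>\<^sub>F N in sequentially. (\<Sum>k. \<bar>bN N k - b k\<bar> * T ^ k) < Br t0"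
    by (rule order_tendstoD(2)) (rule Br_pos[OF t0(1)])
  have "(\<lambda>N. T * (\<Sum>i<d N. (1 / z N i) ^ 3) - (\<Sum>i<d N. (1 / z N i) ^ 2)) \<longlonglongrightarrow> T * s3 - s2"
    by (intro tendsto_intros newton_sums_tendsto[OF coeffs(2)])
  moreover have "0 < T * s3 - s2" using T s_pos by (simp add: field_simps)
  ultimately have "\<forall>\<^sub>F N in sequentially. 0 < T * (\<Sum>i<d N. (1 / z N i) ^ 3) - (\<Sum>i<d N. (1 / z N i) ^ 2)"
    by (rule order_tendstoD(1))
  with ev1 have "\<forall>\<^sub>F N in sequentially. False"
  proof eventually_elim
    case (elim N)
    \<comment> \<open>If all roots were at least \<open>T\<close>, then
      \<open>T * (1 / z N i) ^ 3 <= (1 / z N i) ^ 2\<close> for each of them, and summation would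
      contradict the limit of the power sums.\<close>
    have "\<exists>i<d N. z N i < T"
    proof (rule ccontr)
      assume no: "\<not> (\<exists>i<d N. z N i < T)"
      have "T * (1 / z N i) ^ 3 \<le> (1 / z N i) ^ 2" if "i < d N" for i
      proof -
        have "T \<le> z N i" using no that by auto
        thus ?thesis using z(1)[OF that] by (simp add: field_simps power2_eq_square power3_eq_cube)
      qed
      hence "(\<Sum>i<d N. T * (1 / z N i) ^ 3) \<le> (\<Sum>i<d N. (1 / z N i) ^ 2)"
        by (intro sum_mono) auto
      thus False using elim(2) by (simp add: sum_distrib_left)
    qed
    then obtain i where i: "i < d N" "z N i < T" by blast
    have "powser (bN N) (of_real (z N i)) = (\<Prod>j<d N. 1 - of_real (z N i) / of_real (z N j))"
      unfolding powser_def bN_def by (rule sums_unique[symmetric, OF root_prod_sums])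
    also have "\<dots> = 0" using i z(1)[OF i(1)] by (intro prod_zero) (auto intro!: bexI[of _ i])
    \<comment> \<open>The approximant vanishes at its root, so the value of \<open>B\<close> there
      equals the approximation error, which is below the minimum \<open>Br t0\<close>.\<close>
    finally have "norm (B (of_real (z N i))) = norm (powser (bN N) (of_real (z N i)) - powser b (of_real (z N i)))"
      by (simp add: B_def b_def[abs_def])
    also have "\<dots> \<le> (\<Sum>k. \<bar>bN N k - b k\<bar> * T ^ k)"
      using i z(1)[OF i(1)] abs_b e_pos by (intro powser_dist_le[OF entire_e bN]) (auto simp: less_imp_le)
    also have "\<dots> < Br t0" by (rule elim(1))
    also have "\<dots> \<le> Br (z N i)" using i z(1)[OF i(1)] by (intro t0(2)) auto
    also have "\<dots> \<le> norm (B (of_real (z N i)))" by (simp add: B_eq)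
    finally show False by simp
  qed
  thus False by simp
qed

text \<open>The slack between \<open>1 / s1\<close> and \<open>1 / sqrt s2\<close> on one side, and
  between \<open>s2 / s3\<close> and \<open>s1 / s2\<close> on the other, turns the weak bounds on a
  supremum into strict ones.\<close>

lemma radius_of_convexity_bounds:
  obtains \<rho> where
    "radius_of_convexity (\<lambda>z. z * powser (\<lambda>k. (- 1) ^ k * c k) (z ^ m)) = ereal \<rho>" and "0 < \<rho>"
    and "1 / e 1 < \<rho> ^ m" and "\<rho> ^ m < e 1 / (e 1 ^ 2 - 2 * e 2)"
proof -
  define f where "f = (\<lambda>z. z * powser (\<lambda>k. (- 1) ^ k * c k) (z ^ m))"
  define S where "S = {r. r > 0 \<and> (\<forall>w\<in>ball 0 (r ^ m). A w \<noteq> 0 \<and> Re (B w / A w) > 0)}"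
  have a: "entire_coeffs (\<lambda>k. (- 1) ^ k * c k)"
    by (rule entire_coeffs_abs[OF entire_c]) (simp add: abs_mult)
  have "S = {r. r > 0 \<and> (\<forall>z\<in>ball 0 r. deriv f z \<noteq> 0 \<and> Re (1 + z * deriv (deriv f) z / deriv f z) > 0)}"
    unfolding S_def f_def A_def B_def
    by (intro Collect_cong conj_cong refl) (rule convexity_condition_iff[OF a m, symmetric])
  hence "radius_of_convexity f = Sup (ereal ` S)"
    unfolding radius_of_convexity_def by (simp only: setcompr_eq_image)
  define r1 where "r1 = 1 / s1"
  define r2 where "r2 = 1 / sqrt s2"
  have "sqrt s2 < s1" using s_pos s_less real_sqrt_less_mono[of s2 "s1 ^ 2"] by simp
  hence "r1 < r2" unfolding r1_def r2_def using s_pos by (intro divide_strict_left_mono) auto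
  then obtain R where R: "r1 < R" "R < r2" using dense by blast
  then obtain R' where R': "R < R'" "R' < r2" using dense by blast
  have "0 < r1" using s_pos by (simp add: r1_def)
  have "R' ^ 2 * s2 < 1"
  proof -
    have "R' ^ 2 < r2 ^ 2" using R R' \<open>0 < r1\<close> by (intro power_strict_mono) auto
    hence "R' ^ 2 * s2 < r2 ^ 2 * s2" using s_pos by (intro mult_strict_right_mono) auto
    also have "r2 ^ 2 * s2 = 1" using s_pos by (simp add: r2_def power_divide)
    finally show ?thesis .
  qed
  hence conv: "A w \<noteq> 0 \<and> Re (B w / A w) > 0" if "norm w \<le> R" for w
    using convex_below[of R R' w] that R R' \<open>0 < r1\<close> by auto
  define r where "r = root m R"
  have r: "0 < r" "r ^ m = R" using R \<open>0 < r1\<close> m by (simp_all add: r_def)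
  have "r \<in> S" unfolding S_def using r conv by auto
  define \<tau> where "\<tau> = root m (s2 / s3)"
  have \<tau>: "0 < \<tau>" "\<tau> ^ m = s2 / s3" using s_pos m by (simp_all add: \<tau>_def)
  have le_\<tau>: "t \<le> \<tau>" if "t \<in> S" for t
  proof (rule ccontr)
    assume "\<not> t \<le> \<tau>"
    hence "\<tau> ^ m < t ^ m" using \<tau> m by (intro power_strict_mono) auto
    then obtain w where w: "w \<in> ball 0 (t ^ m)" "B w = 0"
      using not_convex_above[of "t ^ m"] \<tau> by auto
    from that have "\<forall>w\<in>ball 0 (t ^ m). A w \<noteq> 0 \<and> Re (B w / A w) > 0" by (simp add: S_def)
    from bspec[OF this w(1)] w(2) show False by simp
  qed
  have "ereal r \<le> Sup (ereal ` S)" using \<open>r \<in> S\<close> by (intro Sup_upper) auto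
  moreover have "Sup (ereal ` S) \<le> ereal \<tau>" using le_\<tau> by (intro Sup_least) auto
  \<comment> \<open>Real bounds from both sides show that the extended-real supremum is
    finite.\<close>
  ultimately obtain \<rho> where \<rho>: "Sup (ereal ` S) = ereal \<rho>" "r \<le> \<rho>" "\<rho> \<le> \<tau>"
    by (cases "Sup (ereal ` S)") auto
  show thesis
  proof
    show "radius_of_convexity (\<lambda>z. z * powser (\<lambda>k. (- 1) ^ k * c k) (z ^ m)) = ereal \<rho>"
      using \<open>radius_of_convexity f = _\<close> \<rho> by (simp add: f_def)
    show "0 < \<rho>" using r \<rho> by simp
    have "r ^ m \<le> \<rho> ^ m" using r \<rho> by (intro power_mono) auto
    thus "1 / e 1 < \<rho> ^ m" using r R by (simp add: r1_def s1_def)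
    have "\<rho> ^ m \<le> s2 / s3" using \<rho> r \<tau> by (metis power_mono less_imp_le order.trans)
    also have "\<dots> < s1 / s2" using s_pos s_less by (simp add: field_simps power2_eq_square)
    finally show "\<rho> ^ m < e 1 / (e 1 ^ 2 - 2 * e 2)" by (simp add: s1_def s2_def)
  qed
qed

end
end
end

subsection \<open>Approximating polynomials\<close>

text \<open>The Leibniz estimate read backwards: the last and largest term dominates. Both bounds
  are carried through the induction, since each yields the other one for the next index.\<close>

lemma alternating_sum_increasing:
  fixes a :: "nat \<Rightarrow> real"
  assumes "\<And>j. 0 \<le> a j" and "\<And>j. j < k \<Longrightarrow> a j \<le> a (Suc j)"
  shows "0 \<le> (- 1) ^ k * (\<Sum>j\<le>k. (- 1) ^ j * a j) \<and> (- 1) ^ k * (\<Sum>j\<le>k. (- 1) ^ j * a j) \<le> a k"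
  using assms(2)
proof (induction k)
  case (Suc k)
  define S where "S = (- 1) ^ k * (\<Sum>j\<le>k. (- 1) ^ j * a j)"
  have "(- 1) ^ Suc k * (\<Sum>j\<le>Suc k. (- 1) ^ j * a j) = a (Suc k) - S"
    by (cases "even k") (simp_all add: S_def)
  moreover have "0 \<le> S" "S \<le> a k" using Suc by (simp_all add: S_def)
  moreover have "a k \<le> a (Suc k)" using Suc.prems by simp
  ultimately show ?case by linarith
qed (use assms(1) in simp)

lemma alternating_sum_decreasing:
  fixes a :: "nat \<Rightarrow> real"
  assumes "k \<le> N" and "\<And>j. 0 \<le> a j" and "\<And>j. k \<le> j \<Longrightarrow> j < N \<Longrightarrow> a (Suc j) \<le> a j"
  shows "0 \<le> (- 1) ^ k * (\<Sum>j=k..N. (- 1) ^ j * a j) \<and> (- 1) ^ k * (\<Sum>j=k..N. (- 1) ^ j * a j) \<le> a k"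
  using assms(1,3)
proof (induction k rule: inc_induct)
  case (step k)
  define S where "S = (- 1) ^ Suc k * (\<Sum>j=Suc k..N. (- 1) ^ j * a j)"
  have "(\<Sum>j=k..N. (- 1) ^ j * a j) = (- 1) ^ k * a k + (\<Sum>j=Suc k..N. (- 1) ^ j * a j)"
    using step.hyps by (intro sum.atLeast_Suc_atMost) simp
  hence "(- 1) ^ k * (\<Sum>j=k..N. (- 1) ^ j * a j) = a k - S"
    by (cases "even k") (simp_all add: S_def)
  moreover have "0 \<le> S" "S \<le> a (Suc k)" using step.IH step.prems by (simp_all add: S_def)
  moreover have "a (Suc k) \<le> a k" using step.hyps step.prems by simp
  ultimately show ?case by linarith
qed (use assms(2) in simp)

text \<open>
  Hutchinson's criterion. At \<open>w = 2 c\<^sub>i / c\<^sub>i\<^sub>+\<^sub>1\<close> the term of index \<open>i + 1\<close> is twice its lower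
  and more than twice its upper neighbour, so it determines the sign of the alternating sum.
\<close>
lemma hutchinson_root_prod:
  fixes c :: "nat \<Rightarrow> real"
  assumes c_0: "c 0 = 1" and c_pos: "\<And>k. 0 < c k"
    and ratio: "\<And>k. 4 * (c k * c (k + 2)) < c (k + 1) ^ 2"
  obtains x where "strict_mono_on {..<N} x" and "\<And>i. i < N \<Longrightarrow> 0 < x i"
    and "\<And>k. coeff (root_prod x N) k = (if k \<le> N then (- 1) ^ k * c k else 0)"
proof -
  define P where "P = (\<Sum>k\<le>N. monom ((- 1) ^ k * c k) k)"
  have coeff_P: "coeff P k = (if k \<le> N then (- 1) ^ k * c k else 0)" for k
    by (simp add: P_def coeff_sum)
  have poly_P: "poly P w = (\<Sum>k\<le>N. (- 1) ^ k * (c k * w ^ k))" for w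
    by (simp add: P_def poly_sum poly_monom mult.assoc)
  \<comment> \<open>At \<open>w = \<rho> k\<close> the terms of index \<open>k\<close> and
    \<open>k + 1\<close> have equal size; the ratio hypothesis says that these points grow by a
    factor of more than \<open>4\<close>.\<close>
  define \<rho> where "\<rho> k = c k / c (Suc k)" for k
  have \<rho>_pos: "0 < \<rho> k" for k using c_pos by (simp add: \<rho>_def)
  have \<rho>_step: "4 * \<rho> k < \<rho> (Suc k)" for k
    using ratio[of k] c_pos[of "Suc k"] c_pos[of "Suc (Suc k)"]
    by (simp add: \<rho>_def field_simps power2_eq_square)
  have "mono \<rho>"
  proof (rule incseq_SucI)
    show "\<rho> k \<le> \<rho> (Suc k)" for k using \<rho>_step[of k] \<rho>_pos[of k] by linarith
  qed
  hence \<rho>_mono: "\<rho> i \<le> \<rho> j" if "i \<le> j" for i j using that by (rule monoD)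
  have sgn: "0 < (- 1) ^ Suc i * poly P (2 * \<rho> i)" if i: "i < N" for i
  proof -
    define w where "w = 2 * \<rho> i"
    have w: "0 < w" using \<rho>_pos by (simp add: w_def)
    define a where "a k = c k * w ^ k" for k
    have a_pos: "0 < a k" for k using c_pos w by (simp add: a_def)
    have a_Suc: "a (Suc k) * \<rho> k = a k * w" for k
      using c_pos[of "Suc k"] by (simp add: a_def \<rho>_def)
    have up: "a k \<le> a (Suc k)" if "\<rho> k \<le> w" for k
    proof -
      have "a (Suc k) * \<rho> k \<le> a (Suc k) * w"
        using that a_pos by (intro mult_left_mono) (auto intro: less_imp_le)
      hence "a k * w \<le> a (Suc k) * w" unfolding a_Suc .
      thus ?thesis using w by simp
    qed
    have down: "a (Suc k) \<le> a k" if "w \<le> \<rho> k" for k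
    proof -
      have "a (Suc k) * w \<le> a (Suc k) * \<rho> k"
        using that a_pos by (intro mult_left_mono) (auto intro: less_imp_le)
      thus ?thesis unfolding a_Suc using w by simp
    qed
    have mid: "a (Suc i) = 2 * a i"
      using a_Suc[of i] \<rho>_pos[of i] by (simp add: w_def)
    have upper: "2 * a (Suc (Suc i)) < a (Suc i)"
    proof -
      have "a (Suc (Suc i)) * (2 * w) < a (Suc (Suc i)) * \<rho> (Suc i)"
        using \<rho>_step[of i] a_pos by (intro mult_strict_left_mono) (auto simp: w_def)
      thus ?thesis unfolding a_Suc using w by simp
    qed
    define L where "L = (\<Sum>k\<le>i. (- 1) ^ k * a k)"
    define U where "U = (\<Sum>k=Suc (Suc i)..N. (- 1) ^ k * a k)"
    have "(\<Sum>k\<le>N. (- 1) ^ k * a k) = L + (\<Sum>k=Suc i..N. (- 1) ^ k * a k)"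
      unfolding L_def using i by (subst sum.union_disjoint[symmetric]) (auto intro!: sum.cong)
    also have "(\<Sum>k=Suc i..N. (- 1) ^ k * a k) = (- 1) ^ Suc i * a (Suc i) + U"
      unfolding U_def using i by (intro sum.atLeast_Suc_atMost) simp
    finally have "(- 1) ^ Suc i * poly P w = a (Suc i) - (- 1) ^ i * L - (- 1) ^ i * U"
      unfolding poly_P a_def[symmetric] by (cases "even i") simp_all
    moreover have "(- 1) ^ i * L \<le> a i"
      unfolding L_def
    proof (rule alternating_sum_increasing[THEN conjunct2])
      fix j assume "j < i"
      hence "\<rho> j \<le> w" using \<rho>_mono[of j i] \<rho>_pos[of i] by (simp add: w_def)
      thus "a j \<le> a (Suc j)" by (rule up)
    qed (use a_pos in \<open>auto intro: less_imp_le\<close>)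
    moreover have "(- 1) ^ i * U \<le> a (Suc (Suc i))"
    proof (cases "Suc (Suc i) \<le> N")
      case True
      have "(- 1) ^ Suc (Suc i) * U \<le> a (Suc (Suc i))"
        unfolding U_def
      proof (rule alternating_sum_decreasing[THEN conjunct2, OF True])
        fix j assume "Suc (Suc i) \<le> j"
        hence "w \<le> \<rho> j"
          using \<rho>_mono[of "Suc i" j] \<rho>_step[of i] \<rho>_pos[of i] by (simp add: w_def)
        thus "a (Suc j) \<le> a j" by (rule down)
      qed (use a_pos in \<open>auto intro: less_imp_le\<close>)
      thus ?thesis by simp
    next
      case False
      thus ?thesis using a_pos[of "Suc (Suc i)"] by (simp add: U_def)
    qed
    \<comment> \<open>The two neighbours bound all the remaining terms: \<open>a i\<close> is half
      of \<open>a (Suc i)\<close> and the upper neighbour is less than half of it.\<close>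
    ultimately show ?thesis using mid upper by (simp add: w_def)
  qed
  define lo where "lo i = (if i = 0 then 0 else 2 * \<rho> (i - 1))" for i
  have P_0: "poly P 0 = 1" using coeff_P[of 0] c_0 by (simp add: poly_0_coeff_0)
  have lo_sgn: "0 < (- 1) ^ i * poly P (lo i)" if "i < N" for i
    using sgn[of "i - 1"] that P_0 by (cases i) (auto simp: lo_def)
  have lo_less: "lo i < 2 * \<rho> i" for i
    using \<rho>_step[of "i - 1"] \<rho>_pos[of "i - 1"] \<rho>_pos[of i] by (cases i) (auto simp: lo_def)
  have root: "\<exists>y. lo i < y \<and> y < 2 * \<rho> i \<and> poly P y = 0" if i: "i < N" for i
  proof -
    have "poly P (lo i) * poly P (2 * \<rho> i) < 0"
      using lo_sgn[OF i] sgn[OF i] by (cases "even i") (auto simp: mult_less_0_iff)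
    thus ?thesis
      using poly_IVT[OF lo_less[of i], of P] by blast
  qed
  then obtain y where y: "lo i < y i" "y i < 2 * \<rho> i" "poly P (y i) = 0" if "i < N" for i
    by metis
  have y_pos: "0 < y i" if "i < N" for i
    using y(1)[OF that] \<rho>_pos[of "i - 1"] by (auto simp: lo_def split: if_splits)
  have mono: "strict_mono_on {..<N} y"
  proof (rule strict_mono_on_lessThanI)
    fix i assume "Suc i < N"
    thus "y i < y (Suc i)" using y(2)[of i] y(1)[of "Suc i"] by (simp add: lo_def)
  qed
  have "P = root_prod y N"
  proof (rule eq_root_prod)
    show "degree P \<le> N" by (rule degree_le) (simp add: coeff_P)
    show "inj_on y {..<N}" using mono by (rule strict_mono_on_imp_inj_on)
    show "y i \<noteq> 0 \<and> poly P (y i) = 0" if "i < N" for i using y(3) y_pos that by force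
  qed (rule P_0)
  thus thesis using that[OF mono y_pos] coeff_P by simp
qed

lemma entire_coeffs_ratio:
  assumes pos: "\<And>k. 0 < c k" and lim: "(\<lambda>k. c (Suc k) / c k) \<longlonglongrightarrow> 0"
  shows "entire_coeffs c"
  unfolding entire_coeffs_def
proof
  fix r :: real
  have "\<forall>\<^sub>F k in sequentially. c (Suc k) / c k < 1 / (2 * (\<bar>r\<bar> + 1))"
    by (rule order_tendstoD(2)[OF lim]) simp
  then obtain N where N: "\<And>k. k \<ge> N \<Longrightarrow> c (Suc k) / c k < 1 / (2 * (\<bar>r\<bar> + 1))"
    unfolding eventually_sequentially by blast
  show "summable (\<lambda>k. c k * r ^ k)"
  proof (rule summable_ratio_test[of "1 / 2" N])
    fix k assume "N \<le> k"
    from N[OF this] have "c (Suc k) * (2 * (\<bar>r\<bar> + 1)) \<le> c k"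
      using pos[of k] by (simp add: field_simps)
    moreover have "c (Suc k) * (2 * \<bar>r\<bar>) \<le> c (Suc k) * (2 * (\<bar>r\<bar> + 1))"
      using pos[of "Suc k"] by simp
    ultimately have "c (Suc k) * (2 * \<bar>r\<bar>) * \<bar>r\<bar> ^ k \<le> c k * \<bar>r\<bar> ^ k"
      by (intro mult_right_mono) auto
    thus "norm (c (Suc k) * r ^ Suc k) \<le> 1 / 2 * norm (c k * r ^ k)"
      using pos by (simp add: abs_mult power_abs abs_of_pos mult_ac)
  qed simp
qed

section \<open>Wall polynomials\<close>

text \<open>The finite q-binomial theorem for \<open>\<Prod>i<N. 1 - s * p ^ i * w\<close>, stated
  as a recursion between consecutive coefficients instead of with Gaussian binomials.\<close>

lemma q_binomial_coeff:
  fixes s p :: real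
  assumes s: "s > 0" and p: "0 < p" "p < 1"
  defines "Q \<equiv> \<lambda>N. coeff (root_prod (\<lambda>i. 1 / (s * p ^ i)) N)"
  shows "Q N (Suc k) * (1 - p ^ Suc k) = - s * (p ^ k - p ^ N) * Q N k"
proof (induction N arbitrary: k)
  case 0
  show ?case by (cases k) (simp_all add: Q_def)
next
  case (Suc N)
  have step: "Q (Suc N) (Suc k) = Q N (Suc k) - s * p ^ N * Q N k" for k
    by (simp add: Q_def root_prod_Suc mult.commute[of "root_prod _ N"])
  have Q_0: "Q N 0 = 1" for N by (simp add: Q_def)
  show ?case
  proof (cases k)
    case 0
    thus ?thesis using Suc[of 0] unfolding step by (simp add: Q_0 algebra_simps)
  next
    case (Suc j)
    define u v where "u = p ^ j" and "v = p ^ N"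
    have 1: "Q N (Suc (Suc j)) * (1 - p * (p * u)) = - s * (p * u - v) * Q N (Suc j)"
      and 2: "Q N (Suc j) * (1 - p * u) = - s * (u - v) * Q N j"
      using Suc.IH[of "Suc j"] Suc.IH[of j] by (simp_all add: u_def v_def)
    have "(Q N (Suc (Suc j)) - s * v * Q N (Suc j)) * (1 - p * (p * u)) =
        - s * (p * u - p * v) * (Q N (Suc j) - s * v * Q N j)"
      using 1 2 by algebra
    thus ?thesis unfolding Suc step by (simp add: u_def v_def)
  qed
qed

text \<open>Both sides are the product of \<open>1 - a * p ^ i\<close> for \<open>i\<close> from
  \<open>k\<close> to \<open>k + M\<close>.\<close>

lemma shifted_product_telescope:
  fixes a p :: real
  shows "(\<Prod>j<M. 1 - a * p ^ (j + Suc k)) * (1 - a * p ^ k) = (\<Prod>j<M. 1 - a * p ^ (j + k)) * (1 - a * p ^ (M + k))"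
proof (induction M)
  case (Suc M)
  have "(\<Prod>j<Suc M. 1 - a * p ^ (j + Suc k)) * (1 - a * p ^ k) =
      ((\<Prod>j<M. 1 - a * p ^ (j + Suc k)) * (1 - a * p ^ k)) * (1 - a * p ^ (M + Suc k))"
    by (simp only: prod.lessThan_Suc mult_ac)
  also have "\<dots> = (\<Prod>j<M. 1 - a * p ^ (j + k)) * (1 - a * p ^ (M + k)) * (1 - a * p ^ (Suc M + k))"
    unfolding Suc by simp
  also have "\<dots> = (\<Prod>j<Suc M. 1 - a * p ^ (j + k)) * (1 - a * p ^ (Suc M + k))"
    by (simp only: prod.lessThan_Suc)
  finally show ?case .
qed simp

text \<open>
  These polynomials are little \<open>q\<close>-Laguerre (Wall) polynomials with base \<open>p\<close>.
\<close>
lemma wall_polynomial_roots: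
  fixes s p a :: real
  assumes s: "s > 0" and p: "0 < p" "p < 1" and a: "0 < a" "a < 1"
  obtains x where "strict_mono_on {..<N} x" and "\<And>i. i < N \<Longrightarrow> 0 < x i"
    and "\<And>k. coeff (root_prod x N) (Suc k) * ((1 - p ^ Suc k) * (1 - a * p ^ k)) =
      - s * (p ^ k - p ^ N) * (1 - a * p ^ (N + k)) * coeff (root_prod x N) k"
proof -
  define Q where "Q = coeff (root_prod (\<lambda>i. 1 / (s * p ^ i)) N)"
  have ap: "0 < a * p ^ j" "a * p ^ j < 1" for j
  proof -
    show "0 < a * p ^ j" using a p by simp
    have "a * p ^ j \<le> a" using a p by (intro mult_left_le power_le_one) auto
    thus "a * p ^ j < 1" using a by linarith
  qed
  \<comment> \<open>The shift with parameter \<open>a * p ^ j\<close> multiplies the coefficient of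
    index \<open>k\<close> by \<open>(1 - a * p ^ (j + k)) / (1 - a * p ^ j)\<close>. The starting
    roots \<open>1 / (s * p ^ i)\<close> have consecutive ratio exactly \<open>1 / p\<close>, and
    each shift preserves the separation.\<close>
  have "\<exists>x. (\<forall>i<N. 0 < x i) \<and> (\<forall>i. Suc i < N \<longrightarrow> x i \<le> p * x (Suc i)) \<and>
      (\<forall>k. coeff (root_prod x N) k = (\<Prod>j<M. (1 - a * p ^ (j + k)) / (1 - a * p ^ j)) * Q k)" for M
  proof (induction M)
    case 0
    show ?case using s p by (intro exI[of _ "\<lambda>i. 1 / (s * p ^ i)"]) (simp add: Q_def)
  next
    case (Suc M)
    then obtain x where x: "\<And>i. i < N \<Longrightarrow> 0 < x i" "\<And>i. Suc i < N \<Longrightarrow> x i \<le> p * x (Suc i)"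
      "\<And>k. coeff (root_prod x N) k = (\<Prod>j<M. (1 - a * p ^ (j + k)) / (1 - a * p ^ j)) * Q k"
      by blast
    define b where "b = a * p ^ M"
    have b: "0 < b" "b < 1" using ap by (simp_all add: b_def)
    obtain y where y: "\<And>i. i < N \<Longrightarrow> 0 < y i" "\<And>i. Suc i < N \<Longrightarrow> y i \<le> p * y (Suc i)"
      "smult (1 / (1 - b)) (root_prod x N - smult b (pcompose (root_prod x N) [:0, p:])) = root_prod y N"
      using q_shift_root_prod[OF p b, of N x] x(1,2) by blast
    have "coeff (root_prod y N) k = (1 - b * p ^ k) / (1 - b) * coeff (root_prod x N) k" for k
      unfolding y(3)[symmetric] by (simp add: coeff_pcompose_linear field_simps)
    hence "coeff (root_prod y N) k = (\<Prod>j<Suc M. (1 - a * p ^ (j + k)) / (1 - a * p ^ j)) * Q k" for k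
      by (simp add: x(3) b_def power_add mult_ac)
    thus ?case using y(1,2) by blast
  qed
  \<comment> \<open>Taking as many shifts as there are roots lets both numbers tend to infinity with
    \<open>N\<close>.\<close>
  from this[of N] obtain x where x: "\<And>i. i < N \<Longrightarrow> 0 < x i" "\<And>i. Suc i < N \<Longrightarrow> x i \<le> p * x (Suc i)"
    "\<And>k. coeff (root_prod x N) k = (\<Prod>j<N. (1 - a * p ^ (j + k)) / (1 - a * p ^ j)) * Q k"
    by blast
  have "strict_mono_on {..<N} x"
  proof (rule strict_mono_on_lessThanI)
    fix i assume i: "Suc i < N"
    have "p * x (Suc i) < x (Suc i)" using x(1)[OF i] p by simp
    thus "x i < x (Suc i)" using x(2)[OF i] by linarith
  qed
  moreover have "coeff (root_prod x N) (Suc k) * ((1 - p ^ Suc k) * (1 - a * p ^ k)) =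
      - s * (p ^ k - p ^ N) * (1 - a * p ^ (N + k)) * coeff (root_prod x N) k" for k
  proof -
    define D where "D = (\<Prod>j<N. 1 - a * p ^ j)"
    define X where "X k = (\<Prod>j<N. 1 - a * p ^ (j + k))" for k
    have coeff: "coeff (root_prod x N) k = X k / D * Q k" for k
      unfolding x(3) X_def D_def by (simp add: prod_dividef)
    have "X (Suc k) * (1 - a * p ^ k) = X k * (1 - a * p ^ (N + k))"
      unfolding X_def by (rule shifted_product_telescope)
    moreover have "Q (Suc k) * (1 - p ^ Suc k) = - s * (p ^ k - p ^ N) * Q k"
      unfolding Q_def by (rule q_binomial_coeff[OF s p])
    ultimately have "(X (Suc k) * (1 - a * p ^ k)) * (Q (Suc k) * (1 - p ^ Suc k)) / D =
        (X k * (1 - a * p ^ (N + k))) * (- s * (p ^ k - p ^ N) * Q k) / D"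
      by simp
    thus ?thesis unfolding coeff by (simp add: mult_ac)
  qed
  ultimately show thesis using that x(1) by blast
qed

section \<open>Approximation of q-hypergeometric coefficients\<close>

context
  fixes c :: "nat \<Rightarrow> real" and s p a b :: real
  assumes s: "s > 0" and p: "0 < p" "p < 1" and a: "0 < a" "a < 1" and b: "0 < b" "b < 1"
    and c_0: "c 0 = 1"
    and c_Suc: "\<And>k. c (Suc k) = c k * (s * p ^ k / ((1 - a * p ^ k) * (1 - b * p ^ k)))"
begin

lemma q_factor_pos: "0 < 1 - a * p ^ k" "0 < 1 - b * p ^ k"
proof -
  have "a * p ^ k \<le> a" "b * p ^ k \<le> b"
    using a b p by (auto intro!: mult_left_le power_le_one)
  thus "0 < 1 - a * p ^ k" "0 < 1 - b * p ^ k" using a b by linarith+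
qed

lemma q_coeffs_pos: "0 < c k"
proof (induction k)
  case (Suc k)
  thus ?case unfolding c_Suc using s p q_factor_pos[of k]
    by (intro mult_pos_pos divide_pos_pos) auto
qed (simp add: c_0)

lemma entire_q_coeffs: "entire_coeffs c"
proof (rule entire_coeffs_ratio[OF q_coeffs_pos])
  have pk: "(\<lambda>k. p ^ k) \<longlonglongrightarrow> 0" using p by (intro LIMSEQ_power_zero) simp
  have "c (Suc k) / c k = s * p ^ k / ((1 - a * p ^ k) * (1 - b * p ^ k))" for k
    using q_coeffs_pos[of k] by (simp add: c_Suc)
  moreover have "(\<lambda>k. s * p ^ k / ((1 - a * p ^ k) * (1 - b * p ^ k))) \<longlonglongrightarrow> s * 0 / ((1 - a * 0) * (1 - b * 0))"
    by (intro tendsto_intros pk) simp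
  ultimately show "(\<lambda>k. c (Suc k) / c k) \<longlonglongrightarrow> 0" by simp
qed

text \<open>The denominators increase with \<open>k\<close>, so consecutive ratios of coefficients
  shrink at least by the factor \<open>p < 1 / 4\<close>, which is Hutchinson's condition.\<close>

lemma real_rooted_limit_small_base:
  assumes "p < 1 / 4"
  shows "\<exists>x d. real_rooted_limit c x d"
proof -
  have ratio: "4 * (c k * c (k + 2)) < c (k + 1) ^ 2" for k
  proof -
    define r where "r k = s * p ^ k / ((1 - a * p ^ k) * (1 - b * p ^ k))" for k
    have r_pos: "0 < r k" for k using s p q_factor_pos[of k] by (simp add: r_def)
    have "r (Suc k) \<le> p * r k"
    proof -
      have "p ^ Suc k \<le> p ^ k" using p by (intro power_decreasing) auto
      hence "1 - a * p ^ k \<le> 1 - a * p ^ Suc k" "1 - b * p ^ k \<le> 1 - b * p ^ Suc k"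
        using a b by (auto intro: mult_left_mono)
      hence "(1 - a * p ^ k) * (1 - b * p ^ k) \<le> (1 - a * p ^ Suc k) * (1 - b * p ^ Suc k)"
        using q_factor_pos[of k] q_factor_pos[of "Suc k"] by (intro mult_mono) linarith+
      hence "s * p ^ Suc k / ((1 - a * p ^ Suc k) * (1 - b * p ^ Suc k))
          \<le> s * p ^ Suc k / ((1 - a * p ^ k) * (1 - b * p ^ k))"
        using s p q_factor_pos[of k] q_factor_pos[of "Suc k"]
        by (intro divide_left_mono mult_pos_pos) simp_all
      thus ?thesis by (simp add: r_def mult_ac)
    qed
    moreover have "4 * (p * r k) < r k" using r_pos[of k] assms by simp
    ultimately have "4 * r (Suc k) < r k" by linarith
    hence "c k * c k * r k * (4 * r (Suc k)) < c k * c k * r k * r k"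
      using r_pos q_coeffs_pos by (intro mult_strict_left_mono) auto
    moreover have "c (Suc j) = c j * r j" for j by (simp only: c_Suc r_def)
    ultimately show ?thesis by (simp add: power2_eq_square mult_ac)
  qed
  have "\<exists>x. strict_mono_on {..<N} x \<and> (\<forall>i<N. 0 < x i) \<and>
      (\<forall>k. coeff (root_prod x N) k = (if k \<le> N then (- 1) ^ k * c k else 0))" for N
    using hutchinson_root_prod[of c N, OF c_0 q_coeffs_pos ratio] by metis
  then obtain x where x: "\<And>N. strict_mono_on {..<N} (x N)" "\<And>N i. i < N \<Longrightarrow> 0 < x N i"
    "\<And>N k. coeff (root_prod (x N) N) k = (if k \<le> N then (- 1) ^ k * c k else 0)"
    by metis
  have "real_rooted_limit c x (\<lambda>N. N)"
  proof
    show "\<bar>coeff (root_prod (x N) N) k\<bar> \<le> c k" for N k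
      using q_coeffs_pos[of k] by (simp add: x(3) abs_mult less_imp_le)
    show "(\<lambda>N. coeff (root_prod (x N) N) k) \<longlonglongrightarrow> (- 1) ^ k * c k" for k
      by (rule tendsto_eventually, rule eventually_mono[OF eventually_ge_at_top[of k]]) (simp add: x(3))
  qed (use x c_0 q_coeffs_pos entire_q_coeffs in auto)
  thus ?thesis by blast
qed

text \<open>For \<open>b = p\<close> the factor \<open>1 - b * p ^ k\<close> is
  \<open>1 - p ^ Suc k\<close>, and the recursion of the Wall polynomials turns into that of
  \<open>c\<close> as \<open>p ^ N\<close> tends to \<open>0\<close>.\<close>

lemma real_rooted_limit_wall:
  assumes "b = p"
  shows "\<exists>x d. real_rooted_limit c x d"
proof -
  have "\<exists>x. strict_mono_on {..<N} x \<and> (\<forall>i<N. 0 < x i) \<and>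
      (\<forall>k. coeff (root_prod x N) (Suc k) * ((1 - p ^ Suc k) * (1 - a * p ^ k)) =
        - s * (p ^ k - p ^ N) * (1 - a * p ^ (N + k)) * coeff (root_prod x N) k)" for N
    using wall_polynomial_roots[OF s p a, of N] by metis
  then obtain x where x: "\<And>N. strict_mono_on {..<N} (x N)" "\<And>N i. i < N \<Longrightarrow> 0 < x N i"
    and rec: "\<And>N k. coeff (root_prod (x N) N) (Suc k) * ((1 - p ^ Suc k) * (1 - a * p ^ k)) =
        - s * (p ^ k - p ^ N) * (1 - a * p ^ (N + k)) * coeff (root_prod (x N) N) k"
    by metis
  define t where "t N = coeff (root_prod (x N) N)" for N
  define D where "D k = (1 - p ^ Suc k) * (1 - a * p ^ k)" for k
  have D: "0 < D k" for k using q_factor_pos[of k] assms by (simp add: D_def)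
  have t_Suc: "t N (Suc k) = - (s * (p ^ k - p ^ N) * (1 - a * p ^ (N + k)) / D k) * t N k" for N k
  proof -
    have "t N (Suc k) * D k = - s * (p ^ k - p ^ N) * (1 - a * p ^ (N + k)) * t N k"
      unfolding t_def D_def by (rule rec)
    moreover have "t N (Suc k) = t N (Suc k) * D k / D k" using D[of k] by simp
    ultimately show ?thesis by simp
  qed
  have c_Suc': "c (Suc k) = s * p ^ k / D k * c k" for k
    using assms by (simp add: c_Suc D_def mult_ac)
  have t_0: "t N 0 = 1" for N by (simp add: t_def)
  \<comment> \<open>Up to the degree, the recursion differs from that of \<open>c\<close> in
    absolute value by replacing \<open>p ^ k\<close> with \<open>p ^ k - p ^ N\<close> and by a
    factor in \<open>[0, 1]\<close>; beyond the degree the coefficients vanish.\<close>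
  have bound: "\<bar>t N k\<bar> \<le> c k" for N k
  proof (induction k)
    case (Suc k)
    show ?case
    proof (cases "Suc k \<le> N")
      case True
      have "0 \<le> p ^ k - p ^ N" "p ^ k - p ^ N \<le> p ^ k" using p True by (auto intro: power_decreasing)
      moreover have "0 \<le> 1 - a * p ^ (N + k)" "1 - a * p ^ (N + k) \<le> 1"
        using q_factor_pos(1)[of "N + k"] a p by (auto intro: less_imp_le)
      ultimately have "(p ^ k - p ^ N) * (1 - a * p ^ (N + k)) \<le> p ^ k * 1"
        and nn: "0 \<le> (p ^ k - p ^ N) * (1 - a * p ^ (N + k))"
        using p by (intro mult_mono mult_nonneg_nonneg; simp)+
      hence "s * ((p ^ k - p ^ N) * (1 - a * p ^ (N + k))) / D k \<le> s * p ^ k / D k"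
        using s D[of k] by (intro divide_right_mono mult_left_mono) auto
      hence "s * ((p ^ k - p ^ N) * (1 - a * p ^ (N + k))) / D k * \<bar>t N k\<bar> \<le> s * p ^ k / D k * c k"
        using Suc s p D[of k] by (intro mult_mono) auto
      moreover have "\<bar>t N (Suc k)\<bar> = s * ((p ^ k - p ^ N) * (1 - a * p ^ (N + k))) / D k * \<bar>t N k\<bar>"
      proof -
        have "0 \<le> s * ((p ^ k - p ^ N) * (1 - a * p ^ (N + k))) / D k"
          using s nn D[of k] by simp
        from abs_of_nonneg[OF this] show ?thesis
          unfolding t_Suc abs_mult by (simp only: abs_minus_cancel mult.assoc)
      qed
      ultimately show ?thesis by (simp add: c_Suc')
    next
      case False
      hence "t N (Suc k) = 0"
        unfolding t_def using degree_root_prod_le[of "x N" N] by (intro coeff_eq_0) simp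
      thus ?thesis using q_coeffs_pos[of "Suc k"] by simp
    qed
  qed (simp add: t_0 c_0)
  have pN: "(\<lambda>N. p ^ N) \<longlonglongrightarrow> 0" using p by (intro LIMSEQ_power_zero) simp
  have lim: "(\<lambda>N. t N k) \<longlonglongrightarrow> (- 1) ^ k * c k" for k
  proof (induction k)
    case (Suc k)
    have "(\<lambda>N. - (s * (p ^ k - p ^ N) * (1 - a * (p ^ N * p ^ k)) / D k) * t N k)
        \<longlonglongrightarrow> - (s * (p ^ k - 0) * (1 - a * (0 * p ^ k)) / D k) * ((- 1) ^ k * c k)"
      using D[of k] by (intro tendsto_intros pN Suc) simp
    thus ?case by (simp add: t_Suc c_Suc' power_add mult_ac)
  qed (simp add: t_0 c_0)
  have "real_rooted_limit c x (\<lambda>N. N)"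
    by unfold_locales
      (use x c_0 q_coeffs_pos entire_q_coeffs bound lim in \<open>auto simp: t_def\<close>)
  thus ?thesis by blast
qed

end

subsection \<open>The q-gamma function and the radius bounds\<close>

lemma convergent_prod_qpochhammer:
  fixes a q :: real
  assumes "\<bar>q\<bar> < 1"
  shows "convergent_prod (\<lambda>k. 1 - a * q ^ k)"
proof (rule abs_convergent_prod_imp_convergent_prod, subst abs_convergent_prod_conv_summable)
  have "summable (\<lambda>k. \<bar>a\<bar> * \<bar>q\<bar> ^ k)"
    using assms by (intro summable_mult summable_geometric) simp
  thus "summable (\<lambda>k. norm (1 - a * q ^ k - 1))"
    by (simp add: abs_mult power_abs)
qed

lemma qpochhammer_inf_pos:
  fixes a q :: real
  assumes "0 < q" "q < 1" "a < 1"
  shows "0 < qpochhammer_inf a q"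
  unfolding qpochhammer_inf_def
proof (rule less_0_prodinf)
  show "0 < 1 - a * q ^ k" for k
  proof (cases "a \<le> 0")
    case True
    hence "a * q ^ k \<le> 0" using assms by (intro mult_nonpos_nonneg) auto
    thus ?thesis by linarith
  next
    case False
    hence "a * q ^ k \<le> a" using assms by (intro mult_left_le power_le_one) auto
    thus ?thesis using assms by linarith
  qed
qed (use assms in \<open>auto intro: convergent_prod_qpochhammer\<close>)

lemma qpochhammer_inf_rec:
  fixes a q :: real
  assumes "0 < q" "q < 1" "a < 1"
  shows "qpochhammer_inf a q = (1 - a) * qpochhammer_inf (a * q) q"
proof -
  have "(\<lambda>n. \<Prod>k\<le>n. 1 - a * q ^ k) \<longlonglongrightarrow> qpochhammer_inf a q" for a
    unfolding qpochhammer_inf_def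
    using assms by (intro convergent_prod_LIMSEQ convergent_prod_qpochhammer) simp
  note lim = this
  have "(\<lambda>n. \<Prod>k\<le>Suc n. 1 - a * q ^ k) \<longlonglongrightarrow> qpochhammer_inf a q"
    using lim[of a] by (rule LIMSEQ_Suc)
  moreover have "(\<Prod>k\<le>Suc n. 1 - a * q ^ k) = (1 - a) * (\<Prod>k\<le>n. 1 - a * q * q ^ k)" for n
    by (subst prod.atMost_Suc_shift) (simp add: mult.assoc)
  moreover have "(\<lambda>n. (1 - a) * (\<Prod>k\<le>n. 1 - a * q * q ^ k)) \<longlonglongrightarrow> (1 - a) * qpochhammer_inf (a * q) q"
    by (intro tendsto_intros lim)
  ultimately show ?thesis by (auto intro: LIMSEQ_unique)
qed

lemma powr_less_one_of_pos:
  fixes q x :: real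
  assumes "0 < q" "q < 1" "0 < x"
  shows "q powr x < 1"
  using powr_less_mono'[of q 0 x] assms by simp

lemma qGamma_pos:
  fixes q x :: real
  assumes "0 < q" "q < 1" "0 < x"
  shows "0 < qGamma q x"
  unfolding qGamma_def using assms powr_less_one_of_pos[OF assms]
  by (intro mult_pos_pos divide_pos_pos qpochhammer_inf_pos) auto

lemma qGamma_plus1:
  fixes q x :: real
  assumes "0 < q" "q < 1" "0 < x"
  shows "qGamma q (x + 1) = (1 - q powr x) / (1 - q) * qGamma q x"
proof -
  have lt: "q powr x < 1" by (rule powr_less_one_of_pos[OF assms])
  define P R where "P = qpochhammer_inf (q powr (x + 1)) q" and "R = (1 - q) powr (1 - (x + 1))"
  have "qpochhammer_inf (q powr x) q = (1 - q powr x) * P"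
    using qpochhammer_inf_rec[OF assms(1,2) lt] assms by (simp add: powr_add P_def)
  moreover have "(1 - q) powr (1 - x) = R * (1 - q)"
    using assms powr_add[of "1 - q" "1 - (x + 1)" 1] by (simp add: R_def)
  ultimately have "qGamma q x = qpochhammer_inf q q / ((1 - q powr x) * P) * (R * (1 - q))"
    by (simp only: qGamma_def of_real_eq_id id_apply)
  moreover have "qGamma q (x + 1) = qpochhammer_inf q q / P * R"
    by (simp only: qGamma_def of_real_eq_id id_apply P_def R_def)
  ultimately show ?thesis using lt assms by simp
qed

lemma qGamma_plus2:
  fixes q x :: real
  assumes "0 < q" "q < 1" "0 < x"
  shows "qGamma q (x + 2) = (1 - q powr x) * (1 - q * q powr x) / (1 - q) ^ 2 * qGamma q x"
  using qGamma_plus1[of q "x + 1"] qGamma_plus1[of q x] assms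
  by (simp add: powr_add power2_eq_square add.assoc mult_ac)

section \<open>Coefficients of the q-Mittag-Leffler type function\<close>

text \<open>The factor \<open>qGamma q (\<gamma> + 1)\<close> normalises the constant term to
  \<open>1\<close>; the alternating sign is left out to keep the entries positive.\<close>

definition qE_coeff :: "real \<Rightarrow> real \<Rightarrow> real \<Rightarrow> nat \<Rightarrow> real" where
  "qE_coeff q \<sigma> \<gamma> k =
     qGamma q (\<gamma> + 1) * \<sigma> ^ (2 * k) * q ^ (k * (k - 1)) / qGamma q (2 * real k + \<gamma> + 1)"

context
  fixes q \<sigma> \<gamma> :: real
  assumes q: "0 < q" "q < 1" and \<sigma>: "0 < \<sigma>" and \<gamma>: "0 \<le> \<gamma>"
begin

lemma qE_coeff_0: "qE_coeff q \<sigma> \<gamma> 0 = 1"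
  using qGamma_pos[of q "\<gamma> + 1"] q \<gamma> by (simp add: qE_coeff_def)

text \<open>Raising \<open>k\<close> by one raises the argument of the q-gamma function by two, so
  its functional equation is used twice. Hence the base \<open>q ^ 2\<close> with the two parameters
  \<open>q powr (\<gamma> + 1)\<close> and \<open>q powr (\<gamma> + 2)\<close>.\<close>

lemma qE_coeff_Suc:
  "qE_coeff q \<sigma> \<gamma> (Suc k) = qE_coeff q \<sigma> \<gamma> k * ((\<sigma> * (1 - q)) ^ 2 * (q ^ 2) ^ k /
     ((1 - q powr (\<gamma> + 1) * (q ^ 2) ^ k) * (1 - q powr (\<gamma> + 2) * (q ^ 2) ^ k)))"
proof -
  define x where "x = 2 * real k + \<gamma> + 1"
  have x: "0 < x" using \<gamma> by (simp add: x_def)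
  have px: "q powr x = q powr (\<gamma> + 1) * (q ^ 2) ^ k"
  proof -
    have "q powr x = q powr (\<gamma> + 1) * q powr (real (2 * k))"
      unfolding powr_add[symmetric] by (simp add: x_def algebra_simps)
    also have "q powr (real (2 * k)) = (q ^ 2) ^ k"
      using q by (subst powr_realpow) (simp_all add: power_mult)
    finally show ?thesis .
  qed
  have "q powr (\<gamma> + 2) = q * q powr (\<gamma> + 1)"
    using q powr_add[of q "\<gamma> + 1" 1] by (simp add: add.assoc mult.commute)
  hence px': "q * q powr x = q powr (\<gamma> + 2) * (q ^ 2) ^ k" by (simp add: px)
  have lt: "q powr x < 1" "q * q powr x < 1"
    using powr_less_one_of_pos[OF q, of x] powr_less_one_of_pos[OF q, of "x + 1"] x q
    by (simp_all add: powr_add mult.commute)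
  have "2 * real (Suc k) + \<gamma> + 1 = x + 2" by (simp add: x_def)
  hence "qE_coeff q \<sigma> \<gamma> (Suc k) =
      qGamma q (\<gamma> + 1) * \<sigma> ^ (2 * Suc k) * q ^ (Suc k * k) / qGamma q (x + 2)"
    by (simp only: qE_coeff_def diff_Suc_1)
  also have "q ^ (Suc k * k) = q ^ (k * (k - 1)) * (q ^ 2) ^ k"
  proof -
    have "Suc k * k = k * (k - 1) + 2 * k" by (cases k) simp_all
    thus ?thesis by (simp only: power_add power_mult)
  qed
  also have "qGamma q (x + 2) = (1 - q powr x) * (1 - q * q powr x) / (1 - q) ^ 2 * qGamma q x"
    by (rule qGamma_plus2[OF q x])
  also have "qGamma q (\<gamma> + 1) * \<sigma> ^ (2 * Suc k) * (q ^ (k * (k - 1)) * (q ^ 2) ^ k) /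
      ((1 - q powr x) * (1 - q * q powr x) / (1 - q) ^ 2 * qGamma q x) =
      qE_coeff q \<sigma> \<gamma> k * ((\<sigma> * (1 - q)) ^ 2 * (q ^ 2) ^ k / ((1 - q powr x) * (1 - q * q powr x)))"
    unfolding qE_coeff_def x_def[symmetric]
    by (simp add: power_mult_distrib power2_eq_square mult_ac)
  finally show ?thesis unfolding px' unfolding px .
qed

lemma qE_eq_powser:
  assumes "entire_coeffs (qE_coeff q \<sigma> \<gamma>)"
  shows "of_real (qGamma q (\<gamma> + 1)) * qE \<gamma> \<sigma> w q = powser (\<lambda>k. (- 1) ^ k * qE_coeff q \<sigma> \<gamma> k) w"
proof -
  define G where "G = qGamma q (\<gamma> + 1)"
  have G: "0 < G" unfolding G_def using q \<gamma> by (intro qGamma_pos) auto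
  define a where "a k = (- 1) ^ k * \<sigma> ^ (2 * k) * q ^ (k * (k - 1)) / qGamma q (2 * real k + \<gamma> + 1)" for k
  have a: "(- 1) ^ k * qE_coeff q \<sigma> \<gamma> k = G * a k" for k
    by (simp add: qE_coeff_def a_def G_def)
  have "entire_coeffs (\<lambda>k. G * a k)"
    by (rule entire_coeffs_abs[OF assms]) (simp add: a[symmetric] abs_mult)
  hence "summable (\<lambda>k. inverse (of_real G) * (of_real (G * a k) * w ^ k))"
    by (intro summable_mult powser_summable)
  hence "summable (\<lambda>k. of_real (a k) * w ^ k)" using G by (simp add: field_simps)
  from suminf_mult[OF this, of "of_real G"] show ?thesis
    unfolding qE_def powser_def a a_def[symmetric] G_def[symmetric]
    by (simp only: of_real_mult mult.assoc)
qed

text \<open>For \<open>\<gamma> = 0\<close> the second parameter equals the base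
  \<open>q ^ 2\<close>, for \<open>\<gamma> = 1\<close> the first does, so Wall polynomials apply in
  both cases. The inequality between \<open>c 1\<close> and \<open>c 2\<close> is
  \<open>4 * e 2 <= e 1 ^ 2\<close> for \<open>m = 1\<close>.\<close>

lemma qE_coeff_real_rooted:
  assumes "\<gamma> \<in> {0, 1} \<or> inverse q * (1 - q) * (1 - q powr (\<gamma> + 1)) * (1 - q powr (\<gamma> + 2)) > 1"
  shows "\<exists>x d. real_rooted_limit (qE_coeff q \<sigma> \<gamma>) x d"
    and "9 * qE_coeff q \<sigma> \<gamma> 2 \<le> 4 * qE_coeff q \<sigma> \<gamma> 1 ^ 2"
proof -
  define s p a b where "s = (\<sigma> * (1 - q)) ^ 2" and "p = q ^ 2"
    and "a = q powr (\<gamma> + 1)" and "b = q powr (\<gamma> + 2)"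
  define c where "c = qE_coeff q \<sigma> \<gamma>"
  have s: "0 < s" using q \<sigma> by (simp add: s_def)
  have p: "0 < p" "p < 1" using q by (simp_all add: p_def power_less_one_iff)
  have a: "0 < a" "a < 1" and b: "0 < b" "b < 1"
    using q \<gamma> by (simp_all add: a_def b_def powr_less_one_of_pos)
  have c_0: "c 0 = 1" unfolding c_def by (rule qE_coeff_0)
  have c_Suc: "c (Suc k) = c k * (s * p ^ k / ((1 - a * p ^ k) * (1 - b * p ^ k)))" for k
    unfolding c_def s_def p_def a_def b_def by (rule qE_coeff_Suc)
  have c_Suc': "c (Suc k) = c k * (s * p ^ k / ((1 - b * p ^ k) * (1 - a * p ^ k)))" for k
    unfolding c_Suc by (simp add: mult.commute)
  have cases: "(a = q \<and> b = p) \<or> (a = p \<and> b = q ^ 3) \<or> p < 1 / 4"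
  proof (cases "\<gamma> \<in> {0, 1}")
    case True
    moreover have "q powr 2 = q ^ 2" "q powr 3 = q ^ 3"
      using q powr_realpow[of q 2] powr_realpow[of q 3] by simp_all
    ultimately show ?thesis using q by (auto simp: a_def b_def p_def)
  next
    case False
    hence "1 < inverse q * (1 - q) * ((1 - a) * (1 - b))"
      using assms by (simp add: a_def b_def mult.assoc)
    \<comment> \<open>Bounding the last two factors by \<open>1\<close> leaves
      \<open>(1 - q) / q > 1\<close>.\<close>
    also have "\<dots> \<le> inverse q * (1 - q) * 1"
      using q a b by (intro mult_left_mono mult_le_one) auto
    finally have "q < 1 / 2" using q by (simp add: field_simps)
    hence "q ^ 2 < (1 / 2) ^ 2" using q by (intro power_strict_mono) auto
    thus ?thesis by (simp add: p_def power2_eq_square)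
  qed
  show "\<exists>x d. real_rooted_limit (qE_coeff q \<sigma> \<gamma>) x d"
    unfolding c_def[symmetric]
    using cases real_rooted_limit_wall[OF s p a b c_0 c_Suc]
      real_rooted_limit_wall[OF s p b a c_0 c_Suc']
      real_rooted_limit_small_base[OF s p a b c_0 c_Suc] by blast
  \<comment> \<open>The inequality \<open>9 * c 2 <= 4 * c 1 ^ 2\<close> with \<open>c 1\<close>,
    \<open>c 2\<close> taken from the recursion and denominators cleared.\<close>
  have key: "9 * p * ((1 - a) * (1 - b)) \<le> 4 * ((1 - a * p) * (1 - b * p))"
    using cases
  proof (elim disjE conjE)
    assume ab: "a = q" "b = p"
    have "2 * q \<le> 1 + q ^ 2" using zero_le_power2[of "1 - q"] by (simp add: power2_eq_square algebra_simps)
    moreover from this have "3 * q \<le> 1 + q + q ^ 2" by simp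
    \<comment> \<open>After division by \<open>(1 - q) * (1 - q ^ 2)\<close>, the factors
      \<open>1 - q ^ 3\<close> and \<open>1 - q ^ 4\<close> become these two polynomials.\<close>
    ultimately have "(3 * q) * (2 * q) \<le> (1 + q + q ^ 2) * (1 + q ^ 2)"
      using q by (intro mult_mono) auto
    hence "9 * q ^ 2 \<le> 4 * ((1 + q + q ^ 2) * (1 + q ^ 2))"
      by (simp add: power2_eq_square) (smt (verit) zero_le_square)
    hence "(1 - q) * (1 - q ^ 2) * (9 * q ^ 2) \<le> (1 - q) * (1 - q ^ 2) * (4 * ((1 + q + q ^ 2) * (1 + q ^ 2)))"
      using q by (intro mult_left_mono mult_nonneg_nonneg) (auto simp: power_le_one)
    thus ?thesis unfolding ab p_def by (simp add: algebra_simps power2_eq_square)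
  next
    assume ab: "a = p" "b = q ^ 3"
    have "2 * q \<le> 1 + q ^ 2" using zero_le_power2[of "1 - q"] by (simp add: power2_eq_square algebra_simps)
    \<comment> \<open>Here \<open>1 - q ^ 4\<close> and \<open>1 - q ^ 5\<close> contribute the
      factors \<open>1 + q ^ 2\<close> and \<open>1 + q + q ^ 2 + q ^ 3 + q ^ 4\<close>; one
      \<open>q\<close> of \<open>p\<close> is absorbed by \<open>2 * q <= 1 + q ^ 2\<close>, the
      other by this estimate.\<close>
    moreover have "9 * (q + q ^ 2 + q ^ 3) \<le> 8 * (1 + q + q ^ 2 + q ^ 3 + q ^ 4)"
    proof -
      have "q ^ 2 \<le> 1" "q ^ 3 \<le> 1" "0 \<le> q ^ 4" using q by (simp_all add: power_le_one)
      thus ?thesis unfolding distrib_left using q by linarith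
    qed
    ultimately have "(2 * q) * (9 * (q + q ^ 2 + q ^ 3)) \<le> (1 + q ^ 2) * (8 * (1 + q + q ^ 2 + q ^ 3 + q ^ 4))"
      by (rule mult_mono) (use q in simp_all)
    hence "(1 - q) * (1 - q ^ 2) * ((2 * q) * (9 * (q + q ^ 2 + q ^ 3)))
        \<le> (1 - q) * (1 - q ^ 2) * ((1 + q ^ 2) * (8 * (1 + q + q ^ 2 + q ^ 3 + q ^ 4)))"
      using q by (intro mult_left_mono mult_nonneg_nonneg) (auto simp: power_le_one)
    moreover have "(1 - q) * (1 - q ^ 2) * ((2 * q) * (9 * (q + q ^ 2 + q ^ 3))) = 2 * (9 * p * ((1 - a) * (1 - b)))"
      unfolding ab p_def by algebra
    moreover have "(1 - q) * (1 - q ^ 2) * ((1 + q ^ 2) * (8 * (1 + q + q ^ 2 + q ^ 3 + q ^ 4))) =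
        2 * (4 * ((1 - a * p) * (1 - b * p)))"
      unfolding ab p_def by algebra
    ultimately show ?thesis by linarith
  next
    assume "p < 1 / 4"
    have "a * p \<le> a" "b * p \<le> b" using a b p by (auto intro!: mult_left_le)
    hence "(1 - a) * (1 - b) \<le> (1 - a * p) * (1 - b * p)"
      using a b by (intro mult_mono) linarith+
    moreover have "9 * p * ((1 - a) * (1 - b)) \<le> 4 * ((1 - a) * (1 - b))"
      using \<open>p < 1 / 4\<close> a b by (intro mult_right_mono mult_nonneg_nonneg) auto
    ultimately show ?thesis by linarith
  qed
  define X Y where "X = (1 - a) * (1 - b)" and "Y = (1 - a * p) * (1 - b * p)"
  have X: "0 < X" using a b by (simp add: X_def)
  have Y: "0 < Y"
  proof -
    have "a * p \<le> a" "b * p \<le> b" using a b p by (auto intro!: mult_left_le)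
    thus ?thesis unfolding Y_def using a b by (intro mult_pos_pos) linarith+
  qed
  have c1: "c 1 = s / X" using c_Suc[of 0] c_0 by (simp add: X_def)
  have c2: "c 2 = s / X * (s * p / Y)" using c_Suc[of 1] c1 by (simp add: Y_def numeral_2_eq_2)
  have "9 * p * X \<le> 4 * Y" using key by (simp add: X_def Y_def)
  hence "9 * p / Y \<le> 4 / X" using X Y by (simp add: field_simps)
  hence "s / X * s * (9 * p / Y) \<le> s / X * s * (4 / X)"
    using s X by (intro mult_left_mono) auto
  thus "9 * qE_coeff q \<sigma> \<gamma> 2 \<le> 4 * qE_coeff q \<sigma> \<gamma> 1 ^ 2"
    unfolding c_def[symmetric] c1 c2 by (simp add: power2_eq_square mult_ac)
qed

text \<open>Common form of both parts: \<open>m = 2\<close> gives \<open>E1 = 9\<close>,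
  \<open>E2 = 25\<close> for \<open>g_fun\<close>, and \<open>m = 1\<close> gives
  \<open>E1 = 4\<close>, \<open>E2 = 9\<close> for \<open>h_fun\<close>.\<close>

lemma radius_of_convexity_qE_bounds:
  fixes m :: nat
  assumes "\<gamma> \<in> {0, 1} \<or> inverse q * (1 - q) * (1 - q powr (\<gamma> + 1)) * (1 - q powr (\<gamma> + 2)) > 1"
    and m: "m > 0"
  defines "E1 \<equiv> (1 + real m) ^ 2" and "E2 \<equiv> (1 + 2 * real m) ^ 2"
  obtains \<rho> where
    "radius_of_convexity (\<lambda>z. z * of_real (qGamma q (\<gamma> + 1)) * qE \<gamma> \<sigma> (z ^ m) q) = ereal \<rho>"
    and "0 < \<rho>"
    and "qGamma q (\<gamma> + 3) / (E1 * \<sigma>\<^sup>2 * qGamma q (\<gamma> + 1)) < \<rho> ^ m"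
    and "\<rho> ^ m < E1 * qGamma q (\<gamma> + 3) * qGamma q (\<gamma> + 5) /
      (\<sigma>\<^sup>2 * (E1\<^sup>2 * qGamma q (\<gamma> + 1) * qGamma q (\<gamma> + 5) - 2 * E2 * q\<^sup>2 * (qGamma q (\<gamma> + 3))\<^sup>2))"
proof -
  define c where "c = qE_coeff q \<sigma> \<gamma>"
  obtain x d where rr: "real_rooted_limit c x d"
    using qE_coeff_real_rooted(1)[OF assms(1)] by (auto simp: c_def)
  then interpret real_rooted_limit c x d .
  define e1 e2 where "e1 = E1 * c 1" and "e2 = E2 * c 2"
  have e: "e m 1 = e1" "e m 2 = e2"
    by (simp_all add: e_def[OF m] e1_def e2_def E1_def E2_def mult.commute)
  \<comment> \<open>Equality holds at \<open>m = 1\<close>; larger \<open>m\<close> only helps,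
    since \<open>m <= m * m\<close>.\<close>
  have E2_le: "4 * E2 \<le> 9 / 4 * E1 ^ 2"
  proof -
    have "2 * (1 + 2 * real m) \<le> 3 / 2 * (1 + real m) ^ 2"
    proof -
      have "1 \<le> real m" using m by simp
      hence "real m \<le> real m * real m" by simp
      hence "2 * (1 + 2 * real m) \<le> 3 / 2 + 3 * real m + 3 / 2 * (real m * real m)"
        unfolding distrib_left using \<open>1 \<le> real m\<close> by linarith
      also have "\<dots> = 3 / 2 * (1 + real m) ^ 2"
        by (simp add: power2_eq_square algebra_simps)
      finally show ?thesis .
    qed
    hence "(2 * (1 + 2 * real m)) ^ 2 \<le> (3 / 2 * (1 + real m) ^ 2) ^ 2"
      by (intro power_mono) auto
    thus ?thesis by (simp add: E1_def E2_def power_mult_distrib power2_eq_square algebra_simps)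
  qed
  have "4 * e2 \<le> e1 ^ 2"
  proof -
    have "9 * c 2 \<le> 4 * c 1 ^ 2"
      unfolding c_def by (rule qE_coeff_real_rooted(2)[OF assms(1)])
    have "4 * e2 = 4 * E2 * c 2" by (simp add: e2_def)
    also have "\<dots> \<le> 9 / 4 * E1 ^ 2 * c 2"
      using E2_le c_pos[of 2] by (intro mult_right_mono) auto
    also have "\<dots> = E1 ^ 2 / 4 * (9 * c 2)" by simp
    also have "\<dots> \<le> E1 ^ 2 / 4 * (4 * c 1 ^ 2)"
      using \<open>9 * c 2 \<le> _\<close> by (intro mult_left_mono) auto
    finally show ?thesis by (simp add: e1_def power_mult_distrib)
  qed
  with radius_of_convexity_bounds[OF m] obtain \<rho> where
    \<rho>: "radius_of_convexity (\<lambda>z. z * powser (\<lambda>k. (- 1) ^ k * c k) (z ^ m)) = ereal \<rho>" "0 < \<rho>"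
      "1 / e1 < \<rho> ^ m" "\<rho> ^ m < e1 / (e1 ^ 2 - 2 * e2)"
    unfolding e by blast
  define G1 G3 G5 where "G1 = qGamma q (\<gamma> + 1)" and "G3 = qGamma q (\<gamma> + 3)" and "G5 = qGamma q (\<gamma> + 5)"
  have G: "0 < G1" "0 < G3" "0 < G5"
    unfolding G1_def G3_def G5_def using q \<gamma> by (auto intro!: qGamma_pos)
  have c1: "c 1 = G1 * \<sigma>\<^sup>2 / G3" and c2: "c 2 = G1 * \<sigma> ^ 4 * q\<^sup>2 / G5"
    by (simp_all add: c_def qE_coeff_def G1_def G3_def G5_def add_ac power2_eq_square)
  have "1 / e1 = G3 / (E1 * \<sigma>\<^sup>2 * G1)" unfolding e1_def c1 by simp
  moreover have "e1 / (e1 ^ 2 - 2 * e2) =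
      E1 * G3 * G5 / (\<sigma>\<^sup>2 * (E1\<^sup>2 * G1 * G5 - 2 * E2 * q\<^sup>2 * G3\<^sup>2))"
  proof -
    define V where "V = E1\<^sup>2 * G1 * G5 - 2 * E2 * q\<^sup>2 * G3\<^sup>2"
    \<comment> \<open>\<open>K\<close> is the factor common to numerator and denominator once
      \<open>c 1\<close> and \<open>c 2\<close> are written with q-gamma values.\<close>
    define K where "K = G1 * \<sigma>\<^sup>2 / (G3\<^sup>2 * G5)"
    have den: "e1 ^ 2 - 2 * e2 = K * (\<sigma>\<^sup>2 * V)"
      unfolding e1_def e2_def c1 c2 V_def K_def using G \<sigma>
      by (simp add: field_simps power2_eq_square power4_eq_xxxx)
    have num: "e1 = K * (E1 * G3 * G5)"
      unfolding e1_def c1 K_def using G by (simp add: field_simps power2_eq_square)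
    have "K \<noteq> 0" using G \<sigma> by (simp add: K_def)
    hence "K * (E1 * G3 * G5) / (K * (\<sigma>\<^sup>2 * V)) = E1 * G3 * G5 / (\<sigma>\<^sup>2 * V)"
      by (rule mult_divide_mult_cancel_left)
    hence "e1 / (e1 ^ 2 - 2 * e2) = E1 * G3 * G5 / (\<sigma>\<^sup>2 * V)"
      unfolding den using num by (simp only:)
    thus ?thesis by (simp add: V_def)
  qed
  moreover have "(\<lambda>z. z * of_real (qGamma q (\<gamma> + 1)) * qE \<gamma> \<sigma> (z ^ m) q) =
      (\<lambda>z. z * powser (\<lambda>k. (- 1) ^ k * c k) (z ^ m))"
    using qE_eq_powser entire_c by (simp add: c_def mult.assoc)
  ultimately show thesis
    using that \<rho> unfolding G1_def G3_def G5_def by simp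
qed

end

theorem theorem1p4:
  fixes q \<sigma> \<gamma> :: real
  assumes "0 < q" and "q < 1" and "\<sigma> > 0" and "0 \<le> \<gamma>" and "\<gamma> < 2"
    and "\<gamma> \<in> {0, 1} \<or>
         \<gamma> \<in> {0<..<2} - {1} \<and>
           inverse q * (1 - q) * (1 - q powr (\<gamma> + 1)) * (1 - q powr (\<gamma> + 2)) > 1"
  shows
    "(ereal (qGamma q (\<gamma> + 3) / (9 * \<sigma>\<^sup>2 * qGamma q (\<gamma> + 1)))
        < (radius_of_convexity (g_fun \<gamma> \<sigma> q))\<^sup>2 \<and>
      (radius_of_convexity (g_fun \<gamma> \<sigma> q))\<^sup>2
        < ereal (9 * qGamma q (\<gamma> + 3) * qGamma q (\<gamma> + 5) /
            (\<sigma>\<^sup>2 * (81 * qGamma q (\<gamma> + 1) * qGamma q (\<gamma> + 5)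
                    - 50 * q\<^sup>2 * (qGamma q (\<gamma> + 3))\<^sup>2)))) \<and>
     (ereal (qGamma q (\<gamma> + 3) / (4 * \<sigma>\<^sup>2 * qGamma q (\<gamma> + 1)))
        < radius_of_convexity (h_fun \<gamma> \<sigma> q) \<and>
      radius_of_convexity (h_fun \<gamma> \<sigma> q)
        < ereal (2 * qGamma q (\<gamma> + 3) * qGamma q (\<gamma> + 5) /
            (\<sigma>\<^sup>2 * (8 * qGamma q (\<gamma> + 1) * qGamma q (\<gamma> + 5)
                    - 9 * q\<^sup>2 * (qGamma q (\<gamma> + 3))\<^sup>2))))"
proof -
  have cond: "\<gamma> \<in> {0, 1} \<or> inverse q * (1 - q) * (1 - q powr (\<gamma> + 1)) * (1 - q powr (\<gamma> + 2)) > 1"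
    using assms(6) by blast
  note bounds = radius_of_convexity_qE_bounds[OF assms(1-4) cond]
  show ?thesis
  proof (intro conjI)
    obtain \<rho> where \<rho>: "radius_of_convexity (g_fun \<gamma> \<sigma> q) = ereal \<rho>"
      "qGamma q (\<gamma> + 3) / (9 * \<sigma>\<^sup>2 * qGamma q (\<gamma> + 1)) < \<rho> ^ 2"
      "\<rho> ^ 2 < 9 * qGamma q (\<gamma> + 3) * qGamma q (\<gamma> + 5) /
        (\<sigma>\<^sup>2 * (81 * qGamma q (\<gamma> + 1) * qGamma q (\<gamma> + 5) - 50 * q\<^sup>2 * (qGamma q (\<gamma> + 3))\<^sup>2))"
      by (rule bounds[of 2]) (simp_all add: g_fun_def[abs_def])
    show "ereal (qGamma q (\<gamma> + 3) / (9 * \<sigma>\<^sup>2 * qGamma q (\<gamma> + 1)))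
        < (radius_of_convexity (g_fun \<gamma> \<sigma> q))\<^sup>2"
      and "(radius_of_convexity (g_fun \<gamma> \<sigma> q))\<^sup>2
        < ereal (9 * qGamma q (\<gamma> + 3) * qGamma q (\<gamma> + 5) /
            (\<sigma>\<^sup>2 * (81 * qGamma q (\<gamma> + 1) * qGamma q (\<gamma> + 5)
                    - 50 * q\<^sup>2 * (qGamma q (\<gamma> + 3))\<^sup>2)))"
      using \<rho> by simp_all
  next
    define V where "V = 8 * qGamma q (\<gamma> + 1) * qGamma q (\<gamma> + 5) - 9 * q\<^sup>2 * (qGamma q (\<gamma> + 3))\<^sup>2"
    \<comment> \<open>The general bound at \<open>m = 1\<close> has the constants \<open>4\<close>,
      \<open>16\<close>, \<open>18\<close>; the stated one arises by cancelling
      \<open>2\<close>.\<close>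
    have "4 * qGamma q (\<gamma> + 3) * qGamma q (\<gamma> + 5) /
        (\<sigma>\<^sup>2 * (16 * qGamma q (\<gamma> + 1) * qGamma q (\<gamma> + 5) - 18 * q\<^sup>2 * (qGamma q (\<gamma> + 3))\<^sup>2)) =
        2 * (2 * qGamma q (\<gamma> + 3) * qGamma q (\<gamma> + 5)) / (2 * (\<sigma>\<^sup>2 * V))"
      by (simp add: V_def algebra_simps)
    hence V: "4 * qGamma q (\<gamma> + 3) * qGamma q (\<gamma> + 5) /
        (\<sigma>\<^sup>2 * (16 * qGamma q (\<gamma> + 1) * qGamma q (\<gamma> + 5) - 18 * q\<^sup>2 * (qGamma q (\<gamma> + 3))\<^sup>2)) =
        2 * qGamma q (\<gamma> + 3) * qGamma q (\<gamma> + 5) / (\<sigma>\<^sup>2 * V)"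
      by (simp only: mult_divide_mult_cancel_left zero_neq_numeral[symmetric] not_False_eq_True)
    obtain \<rho> where \<rho>: "radius_of_convexity (h_fun \<gamma> \<sigma> q) = ereal \<rho>"
      "qGamma q (\<gamma> + 3) / (4 * \<sigma>\<^sup>2 * qGamma q (\<gamma> + 1)) < \<rho>"
      "\<rho> < 4 * qGamma q (\<gamma> + 3) * qGamma q (\<gamma> + 5) /
        (\<sigma>\<^sup>2 * (16 * qGamma q (\<gamma> + 1) * qGamma q (\<gamma> + 5) - 18 * q\<^sup>2 * (qGamma q (\<gamma> + 3))\<^sup>2))"
      by (rule bounds[of 1]) (simp_all add: h_fun_def[abs_def])
    show "ereal (qGamma q (\<gamma> + 3) / (4 * \<sigma>\<^sup>2 * qGamma q (\<gamma> + 1))) < radius_of_convexity (h_fun \<gamma> \<sigma> q)"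
      and "radius_of_convexity (h_fun \<gamma> \<sigma> q)
        < ereal (2 * qGamma q (\<gamma> + 3) * qGamma q (\<gamma> + 5) /
            (\<sigma>\<^sup>2 * (8 * qGamma q (\<gamma> + 1) * qGamma q (\<gamma> + 5)
                    - 9 * q\<^sup>2 * (qGamma q (\<gamma> + 3))\<^sup>2)))"
      using \<rho> unfolding V by (simp_all add: V_def)
  qed
qed

end
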